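(* Let $G=(V,E)$ be a graph without isolated vertices and let $\beta$ be the cardinality of a minimum edge cover of $G$. For any edge weight $w$ and vertex measure $\mu$ on $G$, $$\beta\ge\max_{\sigma}\#\{k: L_k(\Gamma^\sigma)=0\},$$ where the maximum is over all signatures $\sigma:E\to\{+1,-1\}$ and $\Gamma^\sigma=(G,\sigma)$ (with the given $w$ and $\mu$).
   Context: $G=(V,E)$ is a finite undirected graph without self-loops, $V=\{1,\dots,n\}$. An edge cover is a set of edges such that every vertex is incident to at least one of them. A signed graph $(G,\sigma)$ has signature $\sigma:E\to\{\pm1\}$, edge weight $w:E\to(0,\infty)$, vertex measure $\mu:V\to(0,\infty)$, potential $\kappa:V\to\mathbb R$. For $p\ge1$ and nonzero $f$, $\mathcal R_p^\sigma(f)=\frac{\sum_{\{i,j\}\in E}w_{ij}|f(i)-\sigma_{ij}f(j)|^p+\sum_i\kappa_i|f(i)|^p}{\sum_i\mu_i|f(i)|^p}$; $\mathcal S_p=\{f:\sum_i\mu_i|f(i)|^p=1\}$; Krasnoselskii genus $\gamma(B)$ of closed symmetric $B\subset\mathbb R^n\setminus\{0\}$: least $k$ with an odd continuous map $B\to\mathbb R^k\setminus\{0\}$; $\mathcal F_k(\mathcal S_p)$ = closed symmetric $B\subset\mathcal S_p$ with $\gamma(B)\ge k$; $\lambda_k^{(p)}=\min_{B\in\mathcal F_k(\mathcal S_p)}\max_{f\in B}\mathcal R_p^\sigma(f)$. Cut-off adjacency eigenvalues: $L_k(\Gamma):=\lim_{p\to\infty}2^{-p}\lambda_k^{(p)}(\Gamma)$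 (limits exist, nonnegative, independent of $\kappa$). *)

theory Defs
  imports "HOL-Analysis.Analysis" "HOL-Library.Extended_Nat"
begin

definition simple_graph :: "('v::{finite,linorder}) set set \<Rightarrow> bool" where
  "simple_graph E \<longleftrightarrow> (\<forall>e\<in>E. \<exists>i j. i \<noteq> j \<and> e = {i, j})"

definition no_isolated_vertices :: "('v::{finite,linorder}) set set \<Rightarrow> bool" where
  "no_isolated_vertices E \<longleftrightarrow> (\<forall>v. \<exists>e\<in>E. v \<in> e)"

definition edge_cover :: "('v::{finite,linorder}) set set \<Rightarrow> 'v set set \<Rightarrow> bool" where
  "edge_cover E C \<longleftrightarrow> C \<subseteq> E \<and> (\<forall>v. \<exists>e\<in>C. v \<in> e)"

definition min_edge_cover_card :: "('v::{finite,linorder}) set set \<Rightarrow> nat" where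
  "min_edge_cover_card E = Min {card C | C. edge_cover E C}"

definition signature :: "('v::{finite,linorder}) set set \<Rightarrow> ('v set \<Rightarrow> real) \<Rightarrow> bool" where
  "signature E \<sigma> \<longleftrightarrow> (\<forall>e\<in>E. \<sigma> e = 1 \<or> \<sigma> e = -1)"

definition rq_num ::
  "('v::{finite,linorder}) set set \<Rightarrow> ('v set \<Rightarrow> real) \<Rightarrow> ('v set \<Rightarrow> real) \<Rightarrow> ('v \<Rightarrow> real)
   \<Rightarrow> real \<Rightarrow> real^('v::{finite,linorder}) \<Rightarrow> real" where
  "rq_num E \<sigma> w \<kappa> p f =
     (\<Sum>(i,j)\<in>{(i,j). i < j \<and> {i,j} \<in> E}. w {i,j} * \<bar>f$i - \<sigma> {i,j} * f$j\<bar> powr p)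
     + (\<Sum>i\<in>UNIV. \<kappa> i * \<bar>f$i\<bar> powr p)"

definition rq_den :: "('v::{finite,linorder} \<Rightarrow> real) \<Rightarrow> real \<Rightarrow> real^('v::{finite,linorder}) \<Rightarrow> real" where
  "rq_den \<mu> p f = (\<Sum>i\<in>UNIV. \<mu> i * \<bar>f$i\<bar> powr p)"

definition rayleigh ::
  "('v::{finite,linorder}) set set \<Rightarrow> ('v set \<Rightarrow> real) \<Rightarrow> ('v set \<Rightarrow> real) \<Rightarrow> ('v \<Rightarrow> real)
   \<Rightarrow> ('v \<Rightarrow> real) \<Rightarrow> real \<Rightarrow> real^('v::{finite,linorder}) \<Rightarrow> real" where
  "rayleigh E \<sigma> w \<mu> \<kappa> p f = rq_num E \<sigma> w \<kappa> p f / rq_den \<mu> p f"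

definition p_sphere :: "('v::{finite,linorder} \<Rightarrow> real) \<Rightarrow> real \<Rightarrow> (real^('v::{finite,linorder})) set" where
  "p_sphere \<mu> p = {f. rq_den \<mu> p f = 1}"

text \<open>Existence of an odd continuous map B -> R^m \ {0}, given by its m components.\<close>
definition odd_map_avoiding_zero :: "(real^'v::finite) set \<Rightarrow> nat \<Rightarrow> bool" where
  "odd_map_avoiding_zero B m \<longleftrightarrow>
     (\<exists>g :: nat \<Rightarrow> real^'v \<Rightarrow> real.
        (\<forall>i<m. continuous_on B (g i)) \<and>
        (\<forall>i<m. \<forall>x\<in>B. g i (- x) = - g i x) \<and>
        (\<forall>x\<in>B. \<exists>i<m. g i x \<noteq> 0))"

definition kgenus :: "(real^'v::finite) set \<Rightarrow> enat" where
  "kgenus B = (if \<exists>m. odd_map_avoiding_zero B m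
               then enat (LEAST m. odd_map_avoiding_zero B m) else \<infinity>)"

definition symmetric_set :: "(real^'v::finite) set \<Rightarrow> bool" where
  "symmetric_set B \<longleftrightarrow> (\<forall>x\<in>B. - x \<in> B)"

definition genus_family :: "nat \<Rightarrow> (real^'v::finite) set \<Rightarrow> (real^'v) set set" where
  "genus_family k S = {B. B \<subseteq> S \<and> closed B \<and> symmetric_set B \<and> kgenus B \<ge> enat k}"

definition var_eig ::
  "('v::{finite,linorder}) set set \<Rightarrow> ('v set \<Rightarrow> real) \<Rightarrow> ('v set \<Rightarrow> real) \<Rightarrow> ('v \<Rightarrow> real)
   \<Rightarrow> ('v \<Rightarrow> real) \<Rightarrow> real \<Rightarrow> nat \<Rightarrow> real" where
  "var_eig E \<sigma> w \<mu> \<kappa> p k =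
     (INF B\<in>genus_family k (p_sphere \<mu> p). SUP f\<in>B. rayleigh E \<sigma> w \<mu> \<kappa> p f)"

definition cutoff_eig ::
  "('v::{finite,linorder}) set set \<Rightarrow> ('v set \<Rightarrow> real) \<Rightarrow> ('v set \<Rightarrow> real) \<Rightarrow> ('v \<Rightarrow> real)
   \<Rightarrow> ('v \<Rightarrow> real) \<Rightarrow> nat \<Rightarrow> real" where
  "cutoff_eig E \<sigma> w \<mu> \<kappa> k = Lim at_top (\<lambda>p::real. var_eig E \<sigma> w \<mu> \<kappa> p k / 2 powr p)"

end

theory Submission
  imports Defs "HOL-Homology.Invariance_of_Domain" "HOL-Real_Asymp.Real_Asymp"
begin

text \<open>Let \<open>C\<close> be a minimum edge cover and \<open>k > card C\<close>; it suffices that the limit defining the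
  \<open>k\<close>-th cut-off eigenvalue exists and is positive.

  Existence: the odd homeomorphism \<open>f \<mapsto> sgn f * \<bar>f\<bar> powr (p / q)\<close> from the \<open>p\<close>-sphere to the
  \<open>q\<close>-sphere preserves the genus and, for \<open>p \<le> q\<close>, does not increase the edge part of
  \<open>R p f / 2 powr p\<close>, because \<open>t powr s\<close> is concave for \<open>s \<le> 1\<close>. It leaves the potential part of the
  numerator unchanged, so after adding a constant to the eigenvalue the rescaled
  eigenvalue is antimonotone in \<open>p\<close>.

  Positivity: a set of genus larger than \<open>card C\<close> contains some \<open>f\<close> with \<open>f i = - \<sigma> e * f j\<close> on every
  edge \<open>e = {i, j}\<close> of \<open>C\<close>, and there the edge part of \<open>R p f\<close> is at least \<open>c * 2 powr p\<close>.

  The infimum over an empty family of sets would be a junk constant, with limit 0 after division by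
  \<open>2 powr p\<close>, so one also needs that the sphere in dimension \<open>n\<close> has genus at least \<open>n\<close>. This is the
  Borsuk-Ulam theorem. It follows from the oddness of the degree of odd maps of spheres, proved by
  induction on the dimension with the library's comparison of the degree of an odd map with that of
  its restriction to the equator. A polynomial approximation makes the image of the equator miss a
  point, which a reflection moves to the pole; then the equator can be pushed into itself.\<close>

section \<open>Odd maps of spheres have odd degree\<close>

text \<open>Radial projection onto the sphere. Points of \<open>nsphere n\<close> are sequences
  vanishing above \<open>n\<close>, so only the coordinates up to \<open>n\<close> enter the
  norm.\<close>

definition normalise :: "nat \<Rightarrow> (nat \<Rightarrow> real) \<Rightarrow> nat \<Rightarrow> real" where
  "normalise n x = (\<lambda>i. x i / sqrt (\<Sum>j\<le>n. (x j)\<^sup>2))"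

definition odd_sphere_map :: "nat \<Rightarrow> ((nat \<Rightarrow> real) \<Rightarrow> nat \<Rightarrow> real) \<Rightarrow> bool" where
  "odd_sphere_map n f \<longleftrightarrow> continuous_map (nsphere n) (nsphere n) f \<and>
     (\<forall>x\<in>topspace (nsphere n). f (\<lambda>i. - x i) = (\<lambda>i. - f x i))"

lemma topspace_nsphere: "topspace (nsphere n) = {x. (\<Sum>i\<le>n. (x i)\<^sup>2) = 1 \<and> (\<forall>i>n. x i = 0)}"
  by (simp add: nsphere)

lemma normalise_uminus: "normalise n (\<lambda>i. - x i) = (\<lambda>i. - normalise n x i)"
  by (simp add: normalise_def)

lemma normalise_nsphere: "x \<in> topspace (nsphere n) \<Longrightarrow> normalise n x = x"
  by (simp add: normalise_def topspace_nsphere)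

lemma normalise_in_nsphere:
  assumes "(\<Sum>i\<le>n. (x i)\<^sup>2) \<noteq> 0" "\<And>i. i > n \<Longrightarrow> x i = 0"
  shows "normalise n x \<in> topspace (nsphere n)"
proof -
  have "(\<Sum>i\<le>n. (x i)\<^sup>2) \<ge> 0" by (simp add: sum_nonneg)
  then have "(\<Sum>i\<le>n. (normalise n x i)\<^sup>2) = 1"
    using assms(1) by (simp add: normalise_def power_divide flip: sum_divide_distrib)
  then show ?thesis
    using assms(2) by (simp add: topspace_nsphere normalise_def)
qed

lemma continuous_map_normalise:
  assumes f: "continuous_map X (powertop_real UNIV) f"
    and nz: "\<And>x. x \<in> topspace X \<Longrightarrow> (\<Sum>i\<le>n. (f x i)\<^sup>2) \<noteq> 0"
    and z: "\<And>x i. x \<in> topspace X \<Longrightarrow> i > n \<Longrightarrow> f x i = 0"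
  shows "continuous_map X (nsphere n) (\<lambda>x. normalise n (f x))"
proof -
  have cf: "continuous_map X euclideanreal (\<lambda>x. f x i)" for i
    using f by (simp add: continuous_map_componentwise_UNIV)
  have "continuous_map X euclideanreal (\<lambda>x. normalise n (f x) i)" for i
    unfolding normalise_def
    by (intro continuous_intros cf) (use nz in auto)
  then have "continuous_map X (powertop_real UNIV) (\<lambda>x. normalise n (f x))"
    by (simp add: continuous_map_componentwise_UNIV)
  moreover have "(\<lambda>x. normalise n (f x)) \<in> topspace X \<rightarrow> topspace (nsphere n)"
    using normalise_in_nsphere nz z by blast
  ultimately show ?thesis
    unfolding nsphere by (simp add: continuous_map_in_subtopology Pi_iff image_subset_iff)
qed

text \<open>A positive inner product keeps the straight segment from \<open>f x\<close> to
  \<open>g x\<close> away from 0, so the linear homotopy can be projected radially to the sphere.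
  Neither map has to take unit vectors as values.\<close>

lemma homotopic_normalise:
  assumes f: "continuous_map (nsphere n) (powertop_real UNIV) f"
    and g: "continuous_map (nsphere n) (powertop_real UNIV) g"
    and fz: "\<And>x i. x \<in> topspace (nsphere n) \<Longrightarrow> i > n \<Longrightarrow> f x i = 0"
    and gz: "\<And>x i. x \<in> topspace (nsphere n) \<Longrightarrow> i > n \<Longrightarrow> g x i = 0"
    and pos: "\<And>x. x \<in> topspace (nsphere n) \<Longrightarrow> (\<Sum>i\<le>n. f x i * g x i) > 0"
  shows "homotopic_with (\<lambda>_. True) (nsphere n) (nsphere n)
           (\<lambda>x. normalise n (f x)) (\<lambda>x. normalise n (g x))"
proof -
  define h where "h = (\<lambda>(t, x) i. (1 - t) * f x i + t * g x i)"
  let ?X = "prod_topology (top_of_set {0..1::real}) (nsphere n)"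
  have cm1: "continuous_map ?X euclideanreal fst"
    using continuous_map_fst continuous_map_into_fulltopology by blast
  have cm2: "continuous_map ?X (nsphere n) snd"
    by (rule continuous_map_snd)
  have cf: "continuous_map ?X euclideanreal (\<lambda>x. f (snd x) i)" for i
    using continuous_map_compose[OF cm2 f] by (simp add: continuous_map_componentwise_UNIV o_def)
  have cg: "continuous_map ?X euclideanreal (\<lambda>x. g (snd x) i)" for i
    using continuous_map_compose[OF cm2 g] by (simp add: continuous_map_componentwise_UNIV o_def)
  have "continuous_map ?X (nsphere n) (\<lambda>z. normalise n (h z))"
  proof (rule continuous_map_normalise)
    show "continuous_map ?X (powertop_real UNIV) h"
      unfolding continuous_map_componentwise_UNIV h_def case_prod_unfold
      by (intro allI continuous_intros cm1 cf cg)
  next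
    fix z assume z: "z \<in> topspace ?X"
    obtain t x where zeq: "z = (t, x)" by force
    with z have t: "0 \<le> t" "t \<le> 1" and x: "x \<in> topspace (nsphere n)" by auto
    have ne: "\<exists>i\<le>n. h z i \<noteq> 0"
    proof (rule ccontr)
      assume "\<not> ?thesis"
      then have 0: "(1 - t) * f x i + t * g x i = 0" if "i \<le> n" for i
        using that by (auto simp: h_def zeq)
      \<comment> \<open>The vanishing combination is paired with \<open>f x\<close> and with
        \<open>g x\<close>. All resulting terms are nonnegative, so both \<open>t\<close> and
        \<open>1 - t\<close> times the positive inner product would be 0.\<close>
      have "(\<Sum>i\<le>n. f x i * ((1 - t) * f x i + t * g x i)) = 0"
           "(\<Sum>i\<le>n. g x i * ((1 - t) * f x i + t * g x i)) = 0"
        using 0 by auto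
      then have e: "(1 - t) * (\<Sum>i\<le>n. (f x i)\<^sup>2) + t * (\<Sum>i\<le>n. f x i * g x i) = 0"
                   "(1 - t) * (\<Sum>i\<le>n. f x i * g x i) + t * (\<Sum>i\<le>n. (g x i)\<^sup>2) = 0"
        by (simp_all add: algebra_simps sum.distrib sum_distrib_left power2_eq_square sum_subtractf)
      have "0 \<le> (1 - t) * (\<Sum>i\<le>n. (f x i)\<^sup>2)" "0 \<le> t * (\<Sum>i\<le>n. (g x i)\<^sup>2)"
        using t by (simp_all add: sum_nonneg)
      moreover have "0 \<le> t * (\<Sum>i\<le>n. f x i * g x i)" "0 \<le> (1 - t) * (\<Sum>i\<le>n. f x i * g x i)"
        using t pos[OF x] by simp_all
      ultimately have "t * (\<Sum>i\<le>n. f x i * g x i) = 0" "(1 - t) * (\<Sum>i\<le>n. f x i * g x i) = 0"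
        using e by linarith+
      then show False using pos[OF x] by auto
    qed
    then show "(\<Sum>i\<le>n. (h z i)\<^sup>2) \<noteq> 0"
      by (auto simp: sum_nonneg_eq_0_iff)
    show "h z i = 0" if "i > n" for i
      using that fz[OF x] gz[OF x] by (simp add: h_def zeq)
  qed
  then show ?thesis
    unfolding homotopic_with_def
    by (intro exI[of _ "\<lambda>z. normalise n (h z)"]) (simp add: h_def)
qed

lemma topspace_nsphere_0:
  "topspace (nsphere 0) = {\<lambda>i. if i = 0 then 1 else 0, \<lambda>i. if i = 0 then -1 else 0}"
  by (auto simp: topspace_nsphere fun_eq_iff power2_eq_1_iff)

text \<open>The sphere is a pair of antipodal points, so an odd map is the identity or the swap. The
  swap is the coordinate reflection, of degree -1.\<close>

lemma odd_Brouwer_degree_nsphere_0: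
  assumes "odd_sphere_map 0 f"
  shows "odd (Brouwer_degree2 0 f)"
proof -
  let ?e = "\<lambda>i::nat. if i = 0 then 1 else (0::real)"
  let ?e' = "\<lambda>i::nat. if i = 0 then -1 else (0::real)"
  have eq: "(\<lambda>i. - ?e i) = ?e'" "(\<lambda>i. - ?e' i) = ?e"
    by auto
  have fe: "f ?e \<in> topspace (nsphere 0)"
    using assms in_topspace_nsphere[of 0] unfolding odd_sphere_map_def continuous_map_def by blast
  have fe': "f ?e' = (\<lambda>i. - f ?e i)"
    using assms in_topspace_nsphere[of 0] eq unfolding odd_sphere_map_def by metis
  consider "f ?e = ?e" | "f ?e = ?e'" using fe unfolding topspace_nsphere_0 by blast
  then show ?thesis
  proof cases
    case 1
    have "Brouwer_degree2 0 f = Brouwer_degree2 0 id"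
      using 1 fe' by (intro Brouwer_degree2_eq) (auto simp: topspace_nsphere_0)
    then show ?thesis by simp
  next
    case 2
    have "Brouwer_degree2 0 f = Brouwer_degree2 0 (\<lambda>x i. if i = 0 then -x i else x i)"
      using 2 fe' by (intro Brouwer_degree2_eq) (auto simp: topspace_nsphere_0)
    then show ?thesis by (simp add: Brouwer_degree2_reflection)
  qed
qed

lemma odd_sphere_map_compose:
  assumes "odd_sphere_map n f" "odd_sphere_map n g"
  shows "odd_sphere_map n (g \<circ> f)"
proof -
  have "f x \<in> topspace (nsphere n)" if "x \<in> topspace (nsphere n)" for x
    using assms(1) that by (auto simp: odd_sphere_map_def continuous_map_def)
  then show ?thesis
    using assms unfolding odd_sphere_map_def
    by (auto intro: continuous_map_compose)
qed


text \<open>Scaling the last coordinate of \<open>k x\<close> by \<open>\<bar>x (Suc m)\<bar>\<close> deforms \<open>k\<close> into a map preserving the equator.\<close>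

lemma odd_Brouwer_degree_avoiding_poles:
  assumes IH: "\<And>g. odd_sphere_map m g \<Longrightarrow> odd (Brouwer_degree2 m g)"
    and k: "odd_sphere_map (Suc m) k"
    and avoid: "\<And>x. x \<in> topspace (nsphere m) \<Longrightarrow> \<exists>i\<le>m. k x i \<noteq> 0"
  shows "odd (Brouwer_degree2 (Suc m) k)"
proof -
  let ?n = "Suc m"
  define q where "q = (\<lambda>x i. if i = ?n then \<bar>x ?n\<bar> * k x i else k x i)"
  define Q where "Q = (\<lambda>x. normalise ?n (q x))"
  have ck: "continuous_map (nsphere ?n) (nsphere ?n) k"
    and ko: "\<And>x. x \<in> topspace (nsphere ?n) \<Longrightarrow> k (\<lambda>i. - x i) = (\<lambda>i. - k x i)"
    using k by (auto simp: odd_sphere_map_def)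
  have ktop: "k x \<in> topspace (nsphere ?n)" if "x \<in> topspace (nsphere ?n)" for x
    using ck that by (auto simp: continuous_map_def)
  have ck': "continuous_map (nsphere ?n) (powertop_real UNIV) k"
    using ck by (simp add: nsphere continuous_map_in_subtopology)
  have cki: "continuous_map (nsphere ?n) euclideanreal (\<lambda>x. k x i)" for i
    using ck' by (simp add: continuous_map_componentwise_UNIV)
  have cqi: "continuous_map (nsphere ?n) euclideanreal (\<lambda>x. q x i)" for i
  proof (cases "i = ?n")
    case True
    then show ?thesis
      by (simp add: q_def) (intro continuous_intros cki continuous_map_nsphere_projection)
  qed (simp add: q_def cki)
  then have cq: "continuous_map (nsphere ?n) (powertop_real UNIV) q"
    by (simp add: continuous_map_componentwise_UNIV)
  have qz: "q x i = 0" if "x \<in> topspace (nsphere ?n)" "i > ?n" for x i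
    using ktop[OF that(1)] that(2) by (simp add: q_def topspace_nsphere)
  \<comment> \<open>The inner product is a sum of nonnegative terms. It could vanish only if
    \<open>k x\<close> is a pole and \<open>x\<close> lies on the equator, which
    \<open>avoid\<close> excludes.\<close>
  have pos: "(\<Sum>i\<le>?n. k x i * q x i) > 0" if x: "x \<in> topspace (nsphere ?n)" for x
  proof -
    have eq: "(\<Sum>i\<le>?n. k x i * q x i) = (\<Sum>i\<le>m. (k x i)\<^sup>2) + \<bar>x ?n\<bar> * (k x ?n)\<^sup>2"
      by (simp add: q_def power2_eq_square)
    have nn: "(\<Sum>i\<le>m. (k x i)\<^sup>2) \<ge> 0" by (simp add: sum_nonneg)
    show ?thesis
    proof (cases "(\<Sum>i\<le>m. (k x i)\<^sup>2) = 0")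
      case False
      then show ?thesis using nn unfolding eq
        by (metis abs_ge_zero add_pos_nonneg less_eq_real_def mult_nonneg_nonneg zero_le_power2)
    next
      case True
      then have 0: "k x i = 0" if "i \<le> m" for i
        using that by (auto simp: sum_nonneg_eq_0_iff)
      have "(k x ?n)\<^sup>2 = 1"
        using ktop[OF x] True by (simp add: topspace_nsphere)
      moreover have "x ?n \<noteq> 0"
      proof
        assume "x ?n = 0"
        then have "x \<in> topspace (nsphere m)"
          using x topspace_nsphere_minus1 by fastforce
        then show False using avoid 0 by blast
      qed
      ultimately show ?thesis unfolding eq using True by simp
    qed
  qed
  have hom: "homotopic_with (\<lambda>_. True) (nsphere ?n) (nsphere ?n) (\<lambda>x. normalise ?n (k x)) Q"
    unfolding Q_def
  proof (rule homotopic_normalise[OF ck' cq])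
    show "k x i = 0" if "x \<in> topspace (nsphere ?n)" "i > ?n" for x i
      using ktop[OF that(1)] that(2) by (simp add: topspace_nsphere)
  qed (use qz pos in auto)
  then have cQ: "continuous_map (nsphere ?n) (nsphere ?n) Q"
    using homotopic_with_imp_continuous_maps by blast
  have "Brouwer_degree2 ?n k = Brouwer_degree2 ?n (\<lambda>x. normalise ?n (k x))"
    by (rule Brouwer_degree2_eq) (simp add: ktop normalise_nsphere)
  then have degQ: "Brouwer_degree2 ?n k = Brouwer_degree2 ?n Q"
    using Brouwer_degree2_homotopic[OF hom] by simp
  have Qo: "Q (\<lambda>i. - x i) = (\<lambda>i. - Q x i)" if "x \<in> topspace (nsphere ?n)" for x
  proof -
    have "q (\<lambda>i. - x i) = (\<lambda>i. - q x i)"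
      using ko[OF that] by (auto simp: q_def)
    then show ?thesis by (simp add: Q_def normalise_uminus)
  qed
  \<comment> \<open>The equator consists of the same sequences as the smaller sphere, so
    \<open>Q\<close> itself serves as its own restriction, and the induction hypothesis applies to
    it.\<close>
  have eqr: "nsphere m = subtopology (nsphere ?n) {x. x ?n = 0}"
    by (rule subtopology_nsphere_equator [symmetric])
  have sub: "topspace (nsphere m) \<subseteq> topspace (nsphere ?n)"
    by (simp add: eqr)
  have Qin: "Q x \<in> topspace (nsphere m)" if "x \<in> topspace (nsphere m)" for x
  proof -
    have "x ?n = 0" using that by (simp add: topspace_nsphere)
    then have "Q x ?n = 0" by (simp add: Q_def q_def normalise_def)
    moreover have "Q x \<in> topspace (nsphere ?n)"
      using cQ that sub by (auto simp: continuous_map_def)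
    ultimately show ?thesis
      using topspace_nsphere_minus1 by fastforce
  qed
  have "continuous_map (nsphere m) (nsphere ?n) Q"
    using cQ by (metis continuous_map_from_subtopology eqr)
  then have "continuous_map (nsphere m) (nsphere m) Q"
    using Qin unfolding eqr by (auto simp: continuous_map_in_subtopology)
  then have "odd (Brouwer_degree2 m Q)"
    using Qo sub by (intro IH) (auto simp: odd_sphere_map_def)
  moreover have "even (Brouwer_degree2 ?n Q - Brouwer_degree2 (?n - Suc 0) Q)"
    by (rule Borsuk_odd_mapping_degree_step[OF cQ]) (use Qo Qin in \<open>auto simp: o_def\<close>)
  ultimately show ?thesis using degQ by simp
qed

text \<open>\<open>R\<close> is the reflection in the hyperplane orthogonal to \<open>a - e\<close>,
  with \<open>e\<close> the pole. It is a linear isometry and an involution exchanging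
  \<open>a\<close> and \<open>e\<close>, hence odd, and only \<open>a\<close> reaches the
  pole.\<close>

lemma nsphere_reflection_to_pole:
  assumes a: "a \<in> topspace (nsphere n)"
  obtains R where "odd_sphere_map n R"
    "\<And>x. x \<in> topspace (nsphere n) \<Longrightarrow> R x = (\<lambda>i. if i = n then 1 else 0) \<Longrightarrow> x = a"
proof -
  define e :: "nat \<Rightarrow> real" where "e = (\<lambda>i. if i = n then 1 else 0)"
  define ip where "ip x y = (\<Sum>i\<le>n. x i * y i)" for x y :: "nat \<Rightarrow> real"
  define v where "v i = a i - e i" for i
  \<comment> \<open>If \<open>a\<close> is already the pole, then \<open>v\<close> is zero, the
    quotient by \<open>ip v v\<close> is 0 and \<open>R\<close> is the identity.\<close>
  define R where "R x = (\<lambda>i. x i - 2 * ip x v / ip v v * v i)" for x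
  have ip_top: "x \<in> topspace (nsphere n) \<longleftrightarrow> ip x x = 1 \<and> (\<forall>i>n. x i = 0)" for x
    by (simp add: topspace_nsphere ip_def power2_eq_square)
  have ipd: "ip (\<lambda>i. x i - c * y i) z = ip x z - c * ip y z" for x y z c
    by (simp add: ip_def algebra_simps sum_subtractf sum_distrib_left)
  have ipc: "ip x y = ip y x" for x y
    by (simp add: ip_def mult.commute)
  have v0: "v = (\<lambda>i. 0)" if "ip v v = 0"
  proof
    fix i
    have "\<forall>i\<le>n. v i = 0"
      using that by (simp add: ip_def sum_nonneg_eq_0_iff)
    then show "v i = 0"
      using a by (cases "i \<le> n") (auto simp: v_def e_def topspace_nsphere)
  qed
  have RR: "ip (R x) z = ip x z - 2 * ip x v / ip v v * ip v z" for x z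
    by (simp only: R_def ipd)
  have Rv: "ip (R x) v = - ip x v" for x
  proof (cases "ip v v = 0")
    case True
    have "ip y v = 0" for y unfolding v0[OF True] by (simp add: ip_def)
    then show ?thesis by simp
  next
    case False
    then show ?thesis by (simp add: RR)
  qed
  have iRR: "R (R x) = x" for x
    unfolding R_def[of "R x"] Rv by (simp add: R_def)
  have norm: "ip (R x) (R x) = ip x x" for x
  proof -
    have "ip (R x) (R x) = ip x (R x) - 2 * ip x v / ip v v * ip v (R x)"
      by (rule RR)
    also have "ip x (R x) = ip x x - 2 * ip x v / ip v v * ip x v"
      by (subst ipc, subst RR) (simp add: ipc)
    also have "ip v (R x) = - ip x v"
      by (subst ipc) (rule Rv)
    finally show ?thesis by simp
  qed
  have ipe: "ip x e = x n" for x
    by (simp add: ip_def e_def if_distrib[where f="\<lambda>y. _ * y"] cong: if_cong)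
  have Re: "R e = a"
  proof -
    have aa: "ip a a = 1" using a by (simp add: ip_top)
    have ee: "e n = 1" by (simp add: e_def)
    have vx: "ip v x = ip a x - ip e x" for x
      using ipd[of a 1 e x] by (simp add: v_def[abs_def])
    have vv: "ip v v = 2 - 2 * a n" and ev: "ip e v = a n - 1"
      using aa ee vx[of v] vx[of a] vx[of e] ipe[of a] ipe[of e] ipc[of a v] ipc[of e v] ipc[of e a]
      by simp_all
    show ?thesis
    proof (cases "ip v v = 0")
      case True
      then show ?thesis using v0 by (simp add: R_def v_def fun_eq_iff)
    next
      case False
      then have "2 * ip e v / ip v v = -1"
        unfolding vv ev by (simp add: field_simps)
      then show ?thesis by (simp add: R_def v_def)
    qed
  qed
  have vz: "v i = 0" if "i > n" for i
    using a that by (simp add: v_def e_def topspace_nsphere)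
  have "continuous_map (nsphere n) euclideanreal (\<lambda>x. R x i)" for i
    unfolding R_def ip_def divide_inverse
    by (intro continuous_intros continuous_map_nsphere_projection continuous_map_real_mult_right) auto
  then have "continuous_map (nsphere n) (powertop_real UNIV) R"
    by (simp add: continuous_map_componentwise_UNIV)
  moreover have Rtop: "R x \<in> topspace (nsphere n)" if "x \<in> topspace (nsphere n)" for x
    using that vz norm by (simp add: ip_top) (simp add: R_def)
  ultimately have "continuous_map (nsphere n) (nsphere n) R"
    unfolding nsphere by (auto simp: continuous_map_in_subtopology)
  moreover have "R (\<lambda>i. - x i) = (\<lambda>i. - R x i)" for x
    by (simp add: R_def ip_def sum_negf fun_eq_iff)
  ultimately have "odd_sphere_map n R" by (simp add: odd_sphere_map_def)
  moreover have "x = a" if "R x = (\<lambda>i. if i = n then 1 else 0)" for x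
    using iRR[of x] Re that by (simp add: e_def)
  ultimately show ?thesis using that by blast
qed

text \<open>A continuous image of the equator may fill the whole sphere, but a differentiable one
  cannot. So \<open>f\<close> is replaced by a nearby odd polynomial map, projected back to the
  sphere. The type \<open>'a\<close> only supplies a Euclidean space with at least
  \<open>m + 2\<close> basis vectors in which to speak of polynomials and derivatives.\<close>

lemma odd_sphere_map_avoiding_approximation:
  assumes f: "odd_sphere_map (Suc m) f" and dim: "Suc m < DIM('a::euclidean_space)"
  obtains h a where "odd_sphere_map (Suc m) h" "Brouwer_degree2 (Suc m) h = Brouwer_degree2 (Suc m) f"
    "a \<in> topspace (nsphere (Suc m))" "a \<notin> h ` topspace (nsphere m)"
proof -
  note [simp del] = sum.atMost_Suc
  let ?n = "Suc m"
  have cf: "continuous_map (nsphere ?n) (nsphere ?n) f"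
    and fo: "\<And>x. x \<in> topspace (nsphere ?n) \<Longrightarrow> f (\<lambda>i. - x i) = (\<lambda>i. - f x i)"
    using f by (auto simp: odd_sphere_map_def)
  have ftop: "f x \<in> topspace (nsphere ?n)" if "x \<in> topspace (nsphere ?n)" for x
    using cf that by (auto simp: continuous_map_def)
  obtain b where b: "bij_betw b {..<DIM('a)} (Basis :: 'a set)"
    by (metis atLeast0LessThan ex_bij_betw_nat_finite finite_Basis)
  have bB: "b i \<in> Basis" if "i \<le> ?n" for i
    using b dim that by (auto simp: bij_betw_def)
  have binj: "inj_on b {..?n}"
    using b dim by (auto simp: bij_betw_def intro: inj_on_subset)
  have bb: "b i \<bullet> b j = (if i = j then 1 else 0)" if "i \<le> ?n" "j \<le> ?n" for i j
    using that bB binj by (auto simp: inner_Basis inj_on_def)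
  \<comment> \<open>\<open>T k\<close> is the span of \<open>b 0, ..., b k\<close>. The maps \<phi>
    and \<psi> are inverse linear isometries between \<open>T (Suc m)\<close> and the sequences
    vanishing above \<open>Suc m\<close>, and \<open>F\<close> is \<open>f\<close> transported along
    them. The equator becomes the unit sphere of \<open>T m\<close>.\<close>
  define T where "T k = {v::'a. \<forall>u\<in>Basis. u \<notin> b ` {..k} \<longrightarrow> v \<bullet> u = 0}" for k
  define \<phi> where "\<phi> v = (\<lambda>i. if i \<le> ?n then v \<bullet> b i else 0)" for v :: 'a
  define \<psi> where "\<psi> x = (\<Sum>i\<le>?n. x i *\<^sub>R b i)" for x :: "nat \<Rightarrow> real"
  have subT: "subspace (T k)" for k
    by (auto simp: T_def subspace_def inner_left_distrib)
  have dimT: "dim (T k) = Suc k" if "k \<le> ?n" for k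
  proof -
    have "dim (T k) = card (b ` {..k})"
      unfolding T_def using bB that by (intro dim_substandard) auto
    also have "\<dots> = Suc k"
      by (subst card_image) (use binj that in \<open>auto intro: inj_on_subset\<close>)
    finally show ?thesis .
  qed
  have \<psi>b: "\<psi> x \<bullet> b i = x i" if "i \<le> ?n" for x i
  proof -
    have "\<psi> x \<bullet> b i = (\<Sum>j\<le>?n. x j * (if j = i then 1 else 0))"
      unfolding \<psi>_def inner_sum_left using that by (intro sum.cong) (auto simp: bb)
    then show ?thesis using that by (simp add: if_distrib cong: if_cong)
  qed
  have \<psi>ip: "\<psi> x \<bullet> w = (\<Sum>i\<le>?n. x i * (w \<bullet> b i))" for x w
    unfolding \<psi>_def inner_sum_left by (simp add: inner_commute)
  have \<psi>T: "\<psi> x \<in> T ?n" for x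
    unfolding T_def \<psi>_def
    using bB by (auto simp: inner_sum_left inner_Basis intro!: sum.neutral)
  have \<psi>Tm: "\<psi> x \<in> T m" if "x ?n = 0" for x
    using bB that unfolding T_def \<psi>_def
    by (auto simp: inner_sum_left inner_Basis le_Suc_eq intro!: sum.neutral)
  have \<phi>\<psi>: "\<phi> (\<psi> x) = x" if "\<forall>i>?n. x i = 0" for x
    using that by (auto simp: \<phi>_def \<psi>b fun_eq_iff)
  have \<psi>\<phi>: "\<psi> (\<phi> v) = v" if v: "v \<in> T ?n" for v
  proof (rule euclidean_eqI)
    fix u :: 'a assume u: "u \<in> Basis"
    show "\<psi> (\<phi> v) \<bullet> u = v \<bullet> u"
    proof (cases "u \<in> b ` {..?n}")
      case True
      then show ?thesis by (auto simp: \<psi>b \<phi>_def)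
    next
      case False
      then show ?thesis using v \<psi>T[of "\<phi> v"] u by (simp add: T_def)
    qed
  qed
  have \<psi>\<psi>: "\<psi> x \<bullet> \<psi> x = (\<Sum>i\<le>?n. (x i)\<^sup>2)" for x
    by (subst \<psi>ip) (simp add: \<psi>b power2_eq_square)
  have \<psi>sph: "\<psi> x \<in> sphere 0 1 \<inter> T ?n" if "x \<in> topspace (nsphere ?n)" for x
    using that \<psi>T \<psi>\<psi>[of x] by (simp add: norm_eq_1 topspace_nsphere)
  have \<phi>norm: "(\<Sum>i\<le>?n. (\<phi> v i)\<^sup>2) = (norm v)\<^sup>2" if "v \<in> T ?n" for v
    using \<psi>\<psi>[of "\<phi> v"] \<psi>\<phi>[OF that] by (simp add: power2_norm_eq_inner)
  have \<phi>sph: "\<phi> v \<in> topspace (nsphere ?n)" if "v \<in> sphere 0 1 \<inter> T ?n" for v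
    using \<phi>norm[of v] that by (simp add: topspace_nsphere \<phi>_def)
  have c\<phi>: "continuous_on UNIV (\<lambda>v. \<phi> v i)" for i
    by (cases "i \<le> ?n") (auto simp: \<phi>_def intro!: continuous_intros)
  have c\<phi>': "continuous_map (top_of_set (sphere 0 1 \<inter> T ?n)) (nsphere ?n) \<phi>"
  proof -
    have "continuous_map (top_of_set (sphere 0 1 \<inter> T ?n)) (powertop_real UNIV) \<phi>"
      using c\<phi> by (auto simp: continuous_map_componentwise_UNIV intro: continuous_on_subset)
    then show ?thesis
      using \<phi>sph unfolding nsphere by (auto simp: continuous_map_in_subtopology)
  qed
  have c\<psi>: "continuous_map (nsphere ?n) euclidean \<psi>"
  proof -
    have "continuous_map euclideanreal euclidean (\<lambda>r. r *\<^sub>R b i)" for i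
      by (simp add: continuous_intros)
    then have "continuous_map (nsphere ?n) euclidean ((\<lambda>r. r *\<^sub>R b i) \<circ> (\<lambda>x. x i))" for i
      by (rule continuous_map_compose[OF continuous_map_nsphere_projection])
    then have "continuous_map (nsphere ?n) euclidean (\<lambda>x. x i *\<^sub>R b i)" for i
      by (simp add: o_def)
    then show ?thesis unfolding \<psi>_def by (intro continuous_map_sum) auto
  qed
  define F where "F = \<psi> \<circ> f \<circ> \<phi>"
  let ?K = "sphere 0 1 \<inter> T ?n"
  have cF: "continuous_on ?K F"
    unfolding F_def continuous_map_iff_continuous[symmetric]
    by (intro continuous_map_compose[OF c\<phi>'] continuous_map_compose[OF cf] c\<psi>)
  have FK: "F v \<in> ?K" if "v \<in> ?K" for v
    using \<psi>sph[OF ftop[OF \<phi>sph[OF that]]] by (simp add: F_def)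
  have compK: "compact ?K"
    by (simp add: compact_Int_closed closed_subspace subT)
  \<comment> \<open>Since \<open>F\<close> has unit values, an error below 1 is what makes the inner
    product with the approximation positive.\<close>
  obtain p where p: "polynomial_function p" "p ` ?K \<subseteq> T ?n" "\<And>v. v \<in> ?K \<Longrightarrow> norm (F v - p v) < 1"
    using Stone_Weierstrass_polynomial_function_subspace[OF compK cF zero_less_one subT, of ?n] FK by blast
  \<comment> \<open>The odd part of \<open>p\<close>. As \<open>F\<close> is odd, the error of
    \<open>P\<close> is at most the mean of the errors of \<open>p\<close> at \<open>v\<close> and
    \<open>- v\<close>, so it stays below 1.\<close>
  define P where "P v = (1/2) *\<^sub>R (p v - p (- v))" for v
  have polyP: "polynomial_function P"
  proof -
    have "polynomial_function (\<lambda>v. p (- v))"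
      using polynomial_function_compose[OF polynomial_function_minus[OF polynomial_function_id] p(1)]
      by (simp add: o_def)
    then show ?thesis unfolding P_def using p(1) by auto
  qed
  have Podd: "P (- v) = - P v" for v
    by (simp add: P_def algebra_simps)
  have negK: "- v \<in> ?K" if "v \<in> ?K" for v
    using that subT[of ?n] by (simp add: subspace_neg)
  have PT: "P v \<in> T ?n" if "v \<in> ?K" for v
    using p(2) that negK[OF that] subT[of ?n] unfolding P_def
    by (intro subspace_scale subspace_diff) auto
  have Fodd: "F (- v) = - F v" if "v \<in> ?K" for v
  proof -
    have "\<phi> (- v) = (\<lambda>i. - \<phi> v i)" by (auto simp: \<phi>_def)
    then show ?thesis using fo[OF \<phi>sph[OF that]]
      by (simp add: F_def \<psi>_def sum_negf)
  qed
  have FP: "F v \<bullet> P v > 0" if "v \<in> ?K" for v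
  proof -
    have "F v - P v = (1/2) *\<^sub>R ((F v - p v) - (F (- v) - p (- v)))"
      by (simp add: P_def Fodd[OF that] algebra_simps flip: scaleR_2)
    then have "norm (F v - P v) \<le> (1/2) * (norm (F v - p v) + norm (F (- v) - p (- v)))"
      using norm_triangle_ineq4[of "F v - p v" "F (- v) - p (- v)"] by simp
    also have "\<dots> < 1" using p(3)[OF that] p(3)[OF negK[OF that]] by simp
    finally have "(norm (F v - P v))\<^sup>2 < 1"
      by (simp add: power_less_one_iff abs_square_less_1)
    moreover have "(norm (F v - P v))\<^sup>2 = (norm (F v))\<^sup>2 + (norm (P v))\<^sup>2 - 2 * (F v \<bullet> P v)"
      by (simp add: power2_norm_eq_inner inner_diff inner_commute algebra_simps)
    moreover have "norm (F v) = 1" using FK[OF that] by simp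
    ultimately show ?thesis by (smt (verit) one_power2 zero_le_power2)
  qed
  have Pnz: "P v \<noteq> 0" if "v \<in> ?K" for v
    using FP[OF that] by auto
  define D where "D v = P v /\<^sub>R norm (P v)" for v
  have Tm: "T m \<subseteq> T ?n" by (auto simp: T_def)
  have Pd: "P differentiable (at v within S)" for v S
    using polyP differentiable_at_polynomial_function by blast
  have "D differentiable_on sphere 0 1 \<inter> T m"
    unfolding differentiable_on_def D_def
  proof
    fix v assume v: "v \<in> sphere 0 1 \<inter> T m"
    then have "P v \<noteq> 0" using Pnz Tm by blast
    then show "(\<lambda>v. P v /\<^sub>R norm (P v)) differentiable at v within sphere 0 1 \<inter> T m"
      by (intro derivative_intros differentiable_compose[of norm P] differentiable_norm_at Pd) auto
  qed
  \<comment> \<open>The unit spheres here belong to subspaces of dimensions \<open>m + 1\<close> and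
    \<open>m + 2\<close>, and a differentiable map cannot be onto the larger one.\<close>
  then have "D ` (sphere 0 1 \<inter> T m) \<noteq> ?K"
    by (intro spheremap_lemma1 subT Tm) (simp_all add: dimT)
  moreover have "D v \<in> ?K" if "v \<in> ?K" for v
    using Pnz[OF that] PT[OF that] subT[of ?n] by (simp add: D_def subspace_scale)
  ultimately obtain a where a: "a \<in> ?K" "a \<notin> D ` (sphere 0 1 \<inter> T m)"
    using Tm by blast
  define h where "h x = normalise ?n (\<phi> (P (\<psi> x)))" for x
  have norm\<phi>: "normalise ?n (\<phi> w) = \<phi> (w /\<^sub>R norm w)" if "w \<in> T ?n" for w
    using that unfolding normalise_def \<phi>norm[OF that]
    by (simp add: \<phi>_def fun_eq_iff divide_inverse mult.commute)
  have hD: "h x = \<phi> (D (\<psi> x))" if "x \<in> topspace (nsphere ?n)" for x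
    using norm\<phi> PT \<psi>sph[OF that] by (simp add: h_def D_def)
  have cg: "continuous_map (nsphere ?n) (powertop_real UNIV) (\<lambda>x. \<phi> (P (\<psi> x)))"
  proof -
    have "continuous_on UNIV P"
      using polyP continuous_on_polymonial_function by blast
    then have "continuous_on UNIV (\<lambda>v. \<phi> (P v) i)" for i
      by (rule continuous_on_compose2[OF c\<phi>[of i]]) simp
    then have "continuous_map (nsphere ?n) euclideanreal ((\<lambda>v. \<phi> (P v) i) \<circ> \<psi>)" for i
      by (intro continuous_map_compose[OF c\<psi>]) simp
    then show ?thesis by (simp add: continuous_map_componentwise_UNIV o_def)
  qed
  have hom: "homotopic_with (\<lambda>_. True) (nsphere ?n) (nsphere ?n) (\<lambda>x. normalise ?n (f x)) h"
    unfolding h_def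
  proof (rule homotopic_normalise[OF _ cg])
    show "continuous_map (nsphere ?n) (powertop_real UNIV) f"
      using cf unfolding nsphere by (simp add: continuous_map_in_subtopology)
  next
    fix x i assume x: "x \<in> topspace (nsphere ?n)" 
    then show "?n < i \<Longrightarrow> f x i = 0" using ftop by (simp add: topspace_nsphere)
    show "?n < i \<Longrightarrow> \<phi> (P (\<psi> x)) i = 0" by (simp add: \<phi>_def)
    have "\<phi> (\<psi> x) = x" using x by (intro \<phi>\<psi>) (simp add: topspace_nsphere)
    then have "F (\<psi> x) = \<psi> (f x)" by (simp add: F_def)
    then have "0 < \<psi> (f x) \<bullet> P (\<psi> x)" using FP[OF \<psi>sph[OF x]] by simp
    also have "\<dots> = (\<Sum>i\<le>?n. f x i * \<phi> (P (\<psi> x)) i)"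
      unfolding \<psi>ip by (rule sum.cong) (auto simp: \<phi>_def)
    finally show "0 < (\<Sum>i\<le>?n. f x i * \<phi> (P (\<psi> x)) i)" .
  qed
  show ?thesis
  proof
    have "\<psi> (\<lambda>i. - x i) = - \<psi> x" for x by (simp add: \<psi>_def sum_negf)
    moreover have "\<phi> (- v) = (\<lambda>i. - \<phi> v i)" for v by (auto simp: \<phi>_def)
    ultimately have "h (\<lambda>i. - x i) = (\<lambda>i. - h x i)" for x
      by (simp add: h_def Podd normalise_uminus)
    then show "odd_sphere_map ?n h"
      using homotopic_with_imp_continuous_maps[OF hom] by (simp add: odd_sphere_map_def)
    have "Brouwer_degree2 ?n (\<lambda>x. normalise ?n (f x)) = Brouwer_degree2 ?n f"
      by (rule Brouwer_degree2_eq) (simp add: ftop normalise_nsphere)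
    then show "Brouwer_degree2 ?n h = Brouwer_degree2 ?n f"
      using Brouwer_degree2_homotopic[OF hom] by simp
    show "\<phi> a \<in> topspace (nsphere ?n)" by (rule \<phi>sph[OF a(1)])
    show "\<phi> a \<notin> h ` topspace (nsphere m)"
    proof
      assume "\<phi> a \<in> h ` topspace (nsphere m)"
      then obtain x where x: "x \<in> topspace (nsphere m)" and eq: "\<phi> a = h x" by blast
      have xn: "x \<in> topspace (nsphere ?n)" and x0: "x ?n = 0"
        using x by (auto simp: topspace_nsphere sum.atMost_Suc)
      have DK: "D (\<psi> x) \<in> ?K"
        using Pnz[OF \<psi>sph[OF xn]] PT[OF \<psi>sph[OF xn]] subT[of ?n] by (simp add: D_def subspace_scale)
      have "a = \<psi> (\<phi> a)" using \<psi>\<phi> a(1) by simp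
      also have "\<dots> = \<psi> (\<phi> (D (\<psi> x)))" using eq hD[OF xn] by simp
      also have "\<dots> = D (\<psi> x)" using \<psi>\<phi> DK by simp
      finally show False using a(2) \<psi>sph[OF xn] \<psi>Tm[of x] x0 by blast
    qed
  qed
qed

text \<open>Induction on \<open>n\<close>: the approximation misses a point on the equator, the
  reflection turns that point into the pole, and the step for maps avoiding the poles applies. The
  type \<open>'a\<close> bounds the dimension by that of the space used for the
  approximation.\<close>

theorem Borsuk_odd_degree:
  assumes "odd_sphere_map n f" "n < DIM('a::euclidean_space)"
  shows "odd (Brouwer_degree2 n f)"
  using assms
proof (induction n arbitrary: f)
  case 0
  then show ?case by (simp add: odd_Brouwer_degree_nsphere_0)
next
  case (Suc m)
  obtain h a where h: "odd_sphere_map (Suc m) h" "Brouwer_degree2 (Suc m) h = Brouwer_degree2 (Suc m) f"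
    and a: "a \<in> topspace (nsphere (Suc m))" "a \<notin> h ` topspace (nsphere m)"
    using odd_sphere_map_avoiding_approximation[where 'a='a, OF Suc.prems] by blast
  obtain R where R: "odd_sphere_map (Suc m) R"
    and Ra: "\<And>x. x \<in> topspace (nsphere (Suc m)) \<Longrightarrow> R x = (\<lambda>i. if i = Suc m then 1 else 0) \<Longrightarrow> x = a"
    using nsphere_reflection_to_pole[OF a(1)] by blast
  have top: "g x \<in> topspace (nsphere (Suc m))"
    if "odd_sphere_map (Suc m) g" "x \<in> topspace (nsphere (Suc m))" for g x
    using that by (auto simp: odd_sphere_map_def continuous_map_def)
  have sub: "x \<in> topspace (nsphere (Suc m))" "(\<lambda>i. - x i) \<in> topspace (nsphere m)"
    if "x \<in> topspace (nsphere m)" for x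
    using that by (auto simp: topspace_nsphere)
  have "odd (Brouwer_degree2 (Suc m) (R \<circ> h))"
  proof (rule odd_Brouwer_degree_avoiding_poles)
    show "odd_sphere_map (Suc m) (R \<circ> h)"
      by (rule odd_sphere_map_compose[OF h(1) R])
    show "odd (Brouwer_degree2 m g)" if "odd_sphere_map m g" for g
      using Suc that by simp
    fix x assume x: "x \<in> topspace (nsphere m)"
    show "\<exists>i\<le>m. (R \<circ> h) x i \<noteq> 0"
    proof (rule ccontr)
      assume 0: "\<not> ?thesis"
      have pole: False if "R (h y) (Suc m) = 1" "y \<in> topspace (nsphere m)" "\<forall>i\<le>m. R (h y) i = 0" for y
      proof -
        have hy: "h y \<in> topspace (nsphere (Suc m))" using top h(1) sub that by blast
        have "R (h y) i = (if i = Suc m then 1 else 0)" for i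
          using top[OF R hy] that by (cases i "Suc m" rule: linorder_cases) (auto simp: topspace_nsphere)
        then have "h y = a" using Ra[OF hy] by blast
        then show False using a(2) that(2) by blast
      qed
      have hx: "h x \<in> topspace (nsphere (Suc m))" using top h(1) sub x by blast
      have "(R (h x) (Suc m))\<^sup>2 = 1"
        using top[OF R hx] 0 by (simp add: topspace_nsphere)
      then consider "R (h x) (Suc m) = 1" | "R (h x) (Suc m) = -1" by (auto simp: power2_eq_1_iff)
      then show False
      proof cases
        case 1
        then show False using pole[OF _ x] 0 by simp
      next
        case 2
        \<comment> \<open>If \<open>x\<close> went to the south pole, its antipode would go to the
          north pole, so one missed point excludes both.\<close>
        have "R (h (\<lambda>i. - x i)) = (\<lambda>i. - R (h x) i)"
          using h(1) R hx sub(1)[OF x] by (simp add: odd_sphere_map_def)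
        then show False using pole[OF _ sub(2)[OF x]] 0 2 by simp
      qed
    qed
  qed
  \<comment> \<open>The degree is multiplicative, and a product is odd only if both factors
    are.\<close>
  then show ?case
    using Brouwer_degree2_compose[of "Suc m" h R] h R by (simp add: odd_sphere_map_def)
qed

section \<open>The genus of spheres\<close>

text \<open>Lower bounds on the genus become a test against every odd map. If there is none, the
  genus is infinite and the test is vacuous.\<close>

lemma kgenus_ge_iff: "enat k \<le> kgenus B \<longleftrightarrow> (\<forall>m. odd_map_avoiding_zero B m \<longrightarrow> k \<le> m)"
proof (cases "\<exists>m. odd_map_avoiding_zero B m")
  case True
  then have "odd_map_avoiding_zero B (LEAST m. odd_map_avoiding_zero B m)"
    by (rule LeastI_ex)
  then show ?thesis
    using True by (auto simp: kgenus_def intro: Least_le order_trans)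
next
  case False
  then show ?thesis by (simp add: kgenus_def)
qed

text \<open>The empty set has genus 0, because the condition on a map with no components is vacuous
  there. This keeps suprema over members from being taken over the empty set.\<close>

lemma genus_family_member_nonempty:
  assumes "B \<in> genus_family k S" "1 \<le> k"
  shows "B \<noteq> {}"
proof
  assume "B = {}"
  then have "odd_map_avoiding_zero B 0"
    by (simp add: odd_map_avoiding_zero_def)
  then show False
    using assms kgenus_ge_iff[of k B] by (auto simp: genus_family_def)
qed

lemma continuous_on_abs_powr:
  assumes "0 < p"
  shows "continuous_on UNIV (\<lambda>f::real^'v. \<bar>f $ i\<bar> powr p)"
  using assms by (intro continuous_on_powr' continuous_intros) auto

lemma continuous_on_rq_den:
  assumes "0 < p"
  shows "continuous_on UNIV (rq_den \<mu> p)"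
  unfolding rq_den_def[abs_def] by (intro continuous_intros continuous_on_abs_powr assms)

lemma rq_den_scaleR: "rq_den \<mu> p (c *\<^sub>R f) = \<bar>c\<bar> powr p * rq_den \<mu> p f"
  by (simp add: rq_den_def abs_mult powr_mult sum_distrib_left algebra_simps)

lemma rq_den_uminus: "rq_den \<mu> p (- f) = rq_den \<mu> p f"
  by (simp add: rq_den_def)

lemma rq_den_pos:
  assumes "\<And>v. \<mu> v > 0" "f \<noteq> 0"
  shows "rq_den \<mu> p f > 0"
proof -
  obtain i where "f $ i \<noteq> 0" using assms(2) by (auto simp: vec_eq_iff)
  then show ?thesis unfolding rq_den_def
    using assms(1) by (intro sum_pos2[of _ i]) (auto simp: less_imp_le)
qed

text \<open>Borsuk-Ulam. With too few components, such a map padded by zeros and normalised would be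
  an odd self-map of the round sphere missing the pole. Missing a point forces degree 0, oddness
  forces an odd degree.\<close>

lemma odd_map_avoiding_zero_p_sphere:
  fixes \<mu> :: "'v::{finite,linorder} \<Rightarrow> real"
  assumes \<mu>: "\<And>v. \<mu> v > 0" and p: "0 < p" and m: "odd_map_avoiding_zero (p_sphere \<mu> p) m"
  shows "CARD('v) \<le> m"
proof (rule ccontr)
  assume "\<not> CARD('v) \<le> m"
  define n where "n = CARD('v) - 1"
  have mn: "m \<le> n" and n: "n < DIM((real,'v) vec)" and Suc_n: "CARD('v) = Suc n"
    using \<open>\<not> CARD('v) \<le> m\<close> by (auto simp: n_def)
  obtain g :: "nat \<Rightarrow> (real,'v) vec \<Rightarrow> real" where g: "\<forall>i<m. continuous_on (p_sphere \<mu> p) (g i)"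
    "\<forall>i<m. \<forall>x\<in>p_sphere \<mu> p. g i (- x) = - g i x" "\<forall>x\<in>p_sphere \<mu> p. \<exists>i<m. g i x \<noteq> 0"
    using m unfolding odd_map_avoiding_zero_def by (elim exE conjE)
  have gc: "continuous_on (p_sphere \<mu> p) (g i)" if "i < m" for i
    using g(1) that by blast
  have go: "g i (- x) = - g i x" if "i < m" "x \<in> p_sphere \<mu> p" for i x
    using g(2) that by blast
  have gz: "\<exists>i<m. g i x \<noteq> 0" if "x \<in> p_sphere \<mu> p" for x
    using g(3) that by blast
  obtain r where r: "bij_betw r (UNIV :: 'v set) {..n}"
    using ex_bij_betw_finite_nat[of "UNIV :: 'v set"] Suc_n
    by (auto simp: atLeast0LessThan lessThan_Suc_atMost)
  define V :: "(nat \<Rightarrow> real) \<Rightarrow> (real,'v) vec" where "V x = (\<Sum>i\<in>UNIV. x (r i) *\<^sub>R axis i 1)" for x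
  \<comment> \<open>The radial map onto the \<open>p\<close>-sphere; the exponent \<open>1/p\<close>
    compensates for the homogeneity of degree \<open>p\<close> of \<open>rq_den\<close>.\<close>
  define sc where "sc f = (1 / rq_den \<mu> p f powr (1/p)) *\<^sub>R f" for f :: "(real,'v) vec"
  have Vi: "V x $ i = x (r i)" for x i
    by (simp add: V_def axis_def if_distrib[where f="\<lambda>y. _ * y"] cong: if_cong)
  have Vneg: "V (\<lambda>i. - x i) = - V x" for x
    by (simp add: vec_eq_iff Vi)
  have scneg: "sc (- f) = - sc f" for f
    by (simp add: sc_def rq_den_uminus)
  have Vnz: "V x \<noteq> 0" if "x \<in> topspace (nsphere n)" for x
  proof
    assume "V x = 0"
    then have "x (r i) = 0" for i by (simp add: Vi[symmetric])
    then have "x j = 0" if "j \<le> n" for j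
      using r that by (metis atMost_iff bij_betw_iff_bijections)
    then show False using \<open>x \<in> topspace (nsphere n)\<close> by (simp add: topspace_nsphere)
  qed
  have den_pos: "rq_den \<mu> p f > 0" if "f \<noteq> 0" for f
    using \<mu> that by (intro rq_den_pos)
  have sc_in: "sc f \<in> p_sphere \<mu> p" if "f \<noteq> 0" for f
    using den_pos[OF that] p
    by (simp add: p_sphere_def sc_def rq_den_scaleR powr_divide powr_powr)
  have csc: "continuous_on (- {0}) sc"
    unfolding sc_def
    using p
    by (intro continuous_intros continuous_on_subset[OF continuous_on_rq_den[OF p]])
       (use den_pos in force)+
  have cV: "continuous_map (nsphere n) (top_of_set (- {0})) V"
  proof -
    have "continuous_map euclideanreal euclidean (\<lambda>t. t *\<^sub>R (axis i 1 :: (real,'v) vec))" for i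
      by (simp add: continuous_intros)
    then have "continuous_map (nsphere n) euclidean ((\<lambda>t. t *\<^sub>R (axis i 1 :: (real,'v) vec)) \<circ> (\<lambda>x. x (r i)))" for i
      by (rule continuous_map_compose[OF continuous_map_nsphere_projection])
    then have "continuous_map (nsphere n) euclidean V"
      unfolding V_def by (intro continuous_map_sum) (auto simp: o_def)
    then show ?thesis using Vnz by (auto simp: continuous_map_in_subtopology)
  qed
  \<comment> \<open>As \<open>m \<le> n\<close>, the coordinate with index \<open>n\<close> is
    always one of the padded zeros.\<close>
  define G where "G x = (\<lambda>i. if i < m then g i (sc (V x)) else 0)" for x
  define H where "H x = normalise n (G x)" for x
  have "continuous_map (nsphere n) euclideanreal (\<lambda>x. G x i)" for i
  proof (cases "i < m")
    case True
    have "continuous_on (- {0}) (\<lambda>f. g i (sc f))"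
      by (rule continuous_on_compose2[OF gc[OF True] csc]) (use sc_in in auto)
    then have "continuous_map (nsphere n) euclideanreal ((\<lambda>f. g i (sc f)) \<circ> V)"
      by (intro continuous_map_compose[OF cV]) simp
    then show ?thesis using True by (simp add: G_def o_def)
  qed (simp add: G_def)
  then have "continuous_map (nsphere n) (powertop_real UNIV) G"
    by (simp add: continuous_map_componentwise_UNIV)
  then have cH: "continuous_map (nsphere n) (nsphere n) H"
    unfolding H_def
  proof (rule continuous_map_normalise)
    fix x assume "x \<in> topspace (nsphere n)"
    then obtain i where "i < m" "g i (sc (V x)) \<noteq> 0"
      using gz sc_in Vnz by metis
    then have "i \<le> n" "G x i \<noteq> 0" using mn by (auto simp: G_def)
    then show "(\<Sum>i\<le>n. (G x i)\<^sup>2) \<noteq> 0" by (auto simp: sum_nonneg_eq_0_iff)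
  qed (use mn in \<open>auto simp: G_def\<close>)
  have "H (\<lambda>i. - x i) = (\<lambda>i. - H x i)" if "x \<in> topspace (nsphere n)" for x
  proof -
    have "G (\<lambda>i. - x i) = (\<lambda>i. - G x i)"
      using go[OF _ sc_in[OF Vnz[OF that]]] by (auto simp: G_def Vneg scneg)
    then show ?thesis by (simp add: H_def normalise_uminus)
  qed
  then have "odd (Brouwer_degree2 n H)"
    using cH n by (intro Borsuk_odd_degree[where 'a="(real,'v) vec"]) (auto simp: odd_sphere_map_def)
  moreover have "(\<lambda>i. if i = n then 1 else 0) \<notin> H ` topspace (nsphere n)"
  proof
    assume "(\<lambda>i. if i = n then 1 else 0) \<in> H ` topspace (nsphere n)"
    then obtain x where "H x = (\<lambda>i. if i = n then 1 else 0)" by auto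
    then have "H x n = 1" by simp
    then show False using mn by (simp add: H_def G_def normalise_def)
  qed
  then have "H ` topspace (nsphere n) \<noteq> topspace (nsphere n)"
    by (auto simp: topspace_nsphere if_distrib[where f="\<lambda>y. y\<^sup>2"] cong: if_cong)
  then have "Brouwer_degree2 n H = 0"
    by (rule Brouwer_degree2_nonsurjective[OF cH])
  ultimately show False by simp
qed

text \<open>The sphere itself witnesses that the family in the definition of \<open>var_eig\<close>
  is nonempty for \<open>k\<close> up to the number of vertices.\<close>

lemma p_sphere_in_genus_family:
  fixes \<mu> :: "'v::{finite,linorder} \<Rightarrow> real"
  assumes "\<And>v. \<mu> v > 0" "0 < p" "k \<le> CARD('v)"
  shows "p_sphere \<mu> p \<in> genus_family k (p_sphere \<mu> p)"
proof -
  have "p_sphere \<mu> p = rq_den \<mu> p -` {1}" by (auto simp: p_sphere_def)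
  then have "closed (p_sphere \<mu> p)"
    by (simp add: closed_vimage[OF closed_singleton continuous_on_rq_den[OF assms(2)]])
  moreover have "symmetric_set (p_sphere \<mu> p)"
    by (simp add: symmetric_set_def p_sphere_def rq_den_uminus)
  moreover have "enat k \<le> kgenus (p_sphere \<mu> p)"
    unfolding kgenus_ge_iff
    using odd_map_avoiding_zero_p_sphere[of \<mu> p, OF assms(1,2)] assms(3) order_trans by blast
  ultimately show ?thesis by (simp add: genus_family_def)
qed

section \<open>Signed powers\<close>

definition signed_powr :: "real \<Rightarrow> real \<Rightarrow> real" where
  "signed_powr s x = sgn x * \<bar>x\<bar> powr s"

text \<open>\<open>sgn\<close> jumps at 0; in this form continuity is visible.\<close>

lemma signed_powr_alt: "signed_powr s x = (max x 0) powr s - (max (- x) 0) powr s"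
  by (simp add: signed_powr_def max_def sgn_if)

lemma signed_powr_of_nonneg: "0 \<le> x \<Longrightarrow> signed_powr s x = x powr s"
  and signed_powr_of_nonpos: "x \<le> 0 \<Longrightarrow> signed_powr s x = - ((- x) powr s)"
  by (simp_all add: signed_powr_def sgn_if)

lemma continuous_on_signed_powr:
  assumes "0 < s"
  shows "continuous_on UNIV (signed_powr s)"
  unfolding signed_powr_alt[abs_def]
  using assms by (intro continuous_on_powr' continuous_intros) auto

lemma abs_signed_powr: "\<bar>signed_powr s x\<bar> = \<bar>x\<bar> powr s"
  by (simp add: signed_powr_def abs_mult sgn_if)

lemma signed_powr_uminus: "signed_powr s (- x) = - signed_powr s x"
  by (simp add: signed_powr_def sgn_minus)

lemma signed_powr_inverse:
  assumes "0 < s"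
  shows "signed_powr (1/s) (signed_powr s x) = x"
proof -
  have "signed_powr (1/s) (signed_powr s x) = sgn (signed_powr s x) * (\<bar>x\<bar> powr s) powr (1/s)"
    unfolding signed_powr_def[of "1/s"] abs_signed_powr ..
  also have "\<dots> = sgn x * \<bar>x\<bar>"
    using assms by (cases "x = 0") (simp_all add: powr_powr signed_powr_def sgn_mult)
  finally show ?thesis by (simp add: sgn_mult_abs)
qed

text \<open>Convexity of the inverse power \<open>1/s\<close> at the points \<open>x powr s\<close>
  and \<open>y powr s\<close>. It is used on the open half-line, so a zero argument is treated apart
  by \<open>2 powr s \<le> 2\<close>.\<close>

lemma powr_midpoint_concave:
  fixes x y s :: real
  assumes "0 \<le> x" "0 \<le> y" "0 < s" "s \<le> 1"
  shows "(x powr s + y powr s) / 2 \<le> ((x + y) / 2) powr s"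
proof -
  have half: "z powr s / 2 \<le> (z / 2) powr s" if "0 \<le> z" for z :: real
  proof -
    have "2 powr s \<le> 2 powr (1::real)" using assms by (intro powr_mono) auto
    then have "z powr s / 2 \<le> z powr s / 2 powr s" by (intro divide_left_mono) auto
    then show ?thesis using that by (simp add: powr_divide)
  qed
  show ?thesis
  proof (cases "x = 0 \<or> y = 0")
    case True
    then show ?thesis using half assms by auto
  next
    case False
    then have pos: "0 < x" "0 < y" using assms by auto
    have "convex_on {0<..} (\<lambda>z::real. z powr (1/s))"
      using assms by (intro powr_convex) simp
    from convex_onD[OF this, of "1/2" "x powr s" "y powr s"] pos
    have "((x powr s + y powr s) / 2) powr (1/s) \<le> (x + y) / 2"
      using assms by (simp add: powr_powr add_divide_distrib)
    then have "(((x powr s + y powr s) / 2) powr (1/s)) powr s \<le> ((x + y) / 2) powr s"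
      using assms by (intro powr_mono2) auto
    then show ?thesis using assms pos by (simp add: powr_powr)
  qed
qed

text \<open>After division by \<open>x\<close> this is \<open>t \<le> t powr s\<close> on the unit
  interval, applied to the two fractions \<open>(x - y) / x\<close> and \<open>y / x\<close>, which
  add up to 1.\<close>

lemma powr_diff_le_powr_of_diff:
  fixes x y s :: real
  assumes "0 \<le> y" "y \<le> x" "0 < s" "s \<le> 1"
  shows "x powr s - y powr s \<le> (x - y) powr s"
proof (cases "x = 0")
  case True
  then show ?thesis using assms by simp
next
  case False
  then have x: "0 < x" using assms by simp
  have le: "t \<le> t powr s" if "0 \<le> t" "t \<le> 1" for t :: real
    using powr_mono'[of s 1 t] that assms by simp
  have "1 = (x - y) / x + y / x" using x by (simp add: field_simps)
  also have "\<dots> \<le> ((x - y) / x) powr s + (y / x) powr s"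
    using assms x by (intro add_mono le) (auto simp: field_simps)
  also have "\<dots> = ((x - y) powr s + y powr s) / x powr s"
    using assms x by (simp add: powr_divide add_divide_distrib)
  finally show ?thesis using x by (simp add: field_simps)
qed

text \<open>The halves match the division by \<open>2 powr p\<close> in the cut-off eigenvalues, and
  \<open>a = - b\<close> gives equality. Opposite signs are midpoint concavity; equal signs are
  subadditivity together with \<open>2 powr s \<le> 2\<close>.\<close>

lemma signed_powr_half_dist:
  assumes "0 < s" "s \<le> 1"
  shows "\<bar>signed_powr s a - signed_powr s b\<bar> / 2 \<le> (\<bar>a - b\<bar> / 2) powr s"
proof -
  have same: "(x powr s - y powr s) / 2 \<le> ((x - y) / 2) powr s" if "0 \<le> y" "y \<le> x" for x y
  proof -
    have "2 powr s \<le> 2 powr (1::real)" using assms by (intro powr_mono) auto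
    then have "(x - y) powr s / 2 \<le> (x - y) powr s / 2 powr s" by (intro divide_left_mono) auto
    then show ?thesis
      using powr_diff_le_powr_of_diff[OF that assms] that by (simp add: powr_divide)
  qed
  have main: "\<bar>signed_powr s a - signed_powr s b\<bar> / 2 \<le> (\<bar>a - b\<bar> / 2) powr s" if "b \<le> a" for a b
  proof -
    consider "0 \<le> b" | "b < 0" "0 \<le> a" | "a < 0" by linarith
    then show ?thesis
    proof cases
      case 1
      then have "b powr s \<le> a powr s" using that assms by (intro powr_mono2) auto
      then show ?thesis using same[of b a] 1 that by (simp add: signed_powr_of_nonneg)
    next
      case 2
      then show ?thesis using powr_midpoint_concave[of a "- b" s] assms
        by (simp add: signed_powr_of_nonneg signed_powr_of_nonpos)
    next
      case 3
      then have "(- a) powr s \<le> (- b) powr s" using that assms by (intro powr_mono2) auto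
      then show ?thesis using same[of "- a" "- b"] 3 that by (simp add: signed_powr_of_nonpos)
    qed
  qed
  show ?thesis using main[of b a] main[of a b] by (cases "b \<le> a") (auto simp: abs_minus_commute)
qed

section \<open>Limits of bounded antimonotone functions\<close>

lemma tendsto_at_top_antimono_bounded:
  fixes g :: "real \<Rightarrow> real"
  assumes anti: "\<And>x y. a \<le> x \<Longrightarrow> x \<le> y \<Longrightarrow> g y \<le> g x" and bd: "\<And>x. a \<le> x \<Longrightarrow> c \<le> g x"
  obtains L where "(g \<longlongrightarrow> L) at_top"
proof
  have bdd: "bdd_below (g ` {a..})" using bd by (intro bdd_belowI2[of _ c]) simp
  show "(g \<longlongrightarrow> (INF x\<in>{a..}. g x)) at_top"
  proof (rule order_tendstoI)
    fix y assume y: "y < (INF x\<in>{a..}. g x)"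
    have "y < g x" if "a \<le> x" for x
      using y cINF_lower[OF bdd, of x] that by simp
    then show "\<forall>\<^sub>F x in at_top. y < g x"
      using eventually_ge_at_top[of a] by (rule eventually_mono[rotated])
  next
    fix y assume "(INF x\<in>{a..}. g x) < y"
    then obtain x where x: "a \<le> x" "g x < y"
      by (subst (asm) cINF_less_iff[OF _ bdd]) auto
    have "g z < y" if "x \<le> z" for z
      using anti[OF x(1) that] x(2) by simp
    then show "\<forall>\<^sub>F z in at_top. g z < y"
      using eventually_ge_at_top[of x] by (rule eventually_mono[rotated])
  qed
qed

section \<open>Transfer between spheres of different exponents\<close>

definition vec_signed_powr :: "real \<Rightarrow> real^'v::finite \<Rightarrow> real^'v" where
  "vec_signed_powr s f = (\<chi> i. signed_powr s (f $ i))"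

lemma continuous_on_vec_signed_powr:
  assumes "0 < s"
  shows "continuous_on UNIV (vec_signed_powr s)"
proof -
  have "continuous_on UNIV (\<lambda>f::real^'v. signed_powr s (f $ i))" for i
    by (rule continuous_on_compose2[OF continuous_on_signed_powr[OF assms]])
      (auto intro: continuous_intros)
  then show ?thesis
    unfolding vec_signed_powr_def[abs_def] by (intro continuous_on_vec_lambda)
qed

lemma vec_signed_powr_uminus: "vec_signed_powr s (- f) = - vec_signed_powr s f"
  by (simp add: vec_signed_powr_def vec_eq_iff signed_powr_uminus)

lemma vec_signed_powr_inverse:
  assumes "0 < s"
  shows "vec_signed_powr (1/s) (vec_signed_powr s f) = f"
    and "vec_signed_powr s (vec_signed_powr (1/s) f) = f"
  using signed_powr_inverse[of s] signed_powr_inverse[of "1/s"] assms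
  by (simp_all add: vec_signed_powr_def vec_eq_iff)

lemma abs_vec_signed_powr:
  assumes "0 < q"
  shows "\<bar>vec_signed_powr (p / q) f $ i\<bar> powr q = \<bar>f $ i\<bar> powr p"
  using assms by (simp add: vec_signed_powr_def abs_signed_powr powr_powr)

lemma rq_den_vec_signed_powr:
  assumes "0 < q"
  shows "rq_den \<mu> q (vec_signed_powr (p / q) f) = rq_den \<mu> p f"
  by (simp add: rq_den_def abs_vec_signed_powr[OF assms])

text \<open>An odd map on the image, composed with the transfer, is an odd map on \<open>B\<close>
  with the same number of components, so the genus cannot drop. The image is closed as the preimage
  of \<open>B\<close> under the inverse transfer.\<close>

lemma vec_signed_powr_genus_family:
  fixes \<mu> :: "'v::{finite,linorder} \<Rightarrow> real"
  assumes p: "0 < p" and q: "0 < q" and B: "B \<in> genus_family k (p_sphere \<mu> p)"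
  shows "vec_signed_powr (p / q) ` B \<in> genus_family k (p_sphere \<mu> q)"
proof -
  let ?T = "vec_signed_powr (p / q) :: (real,'v) vec \<Rightarrow> _"
  have s: "0 < p / q" "0 < 1 / (p / q)" using p q by auto
  have B': "B \<subseteq> p_sphere \<mu> p" "closed B" "symmetric_set B" "enat k \<le> kgenus B"
    using B by (auto simp: genus_family_def)
  have "?T ` B \<subseteq> p_sphere \<mu> q"
    using B'(1) by (auto simp: p_sphere_def rq_den_vec_signed_powr[OF q])
  moreover have "f \<in> ?T ` B" if "vec_signed_powr (1 / (p / q)) f \<in> B" for f
    using imageI[OF that, of ?T] unfolding vec_signed_powr_inverse(2)[OF s(1)] .
  then have "?T ` B = vec_signed_powr (1 / (p / q)) -` B"
    using vec_signed_powr_inverse(1)[OF s(1)] by fastforce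
  then have "closed (?T ` B)"
    by (simp only: closed_vimage[OF B'(2) continuous_on_vec_signed_powr[OF s(2)]])
  moreover have "symmetric_set (?T ` B)"
    using B'(3) by (auto simp: symmetric_set_def simp flip: vec_signed_powr_uminus)
  moreover have "enat k \<le> kgenus (?T ` B)"
    unfolding kgenus_ge_iff
  proof (intro allI impI)
    fix m assume "odd_map_avoiding_zero (?T ` B) m"
    then obtain g :: "nat \<Rightarrow> (real,'v) vec \<Rightarrow> real" where
      g: "\<forall>i<m. continuous_on (?T ` B) (g i)" "\<forall>i<m. \<forall>x\<in>?T ` B. g i (- x) = - g i x"
        "\<forall>x\<in>?T ` B. \<exists>i<m. g i x \<noteq> 0"
      unfolding odd_map_avoiding_zero_def by (elim exE conjE)
    have "continuous_on B (\<lambda>f. g i (?T f))" if "i < m" for i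
      using g(1) that
      by (intro continuous_on_compose2[of "?T ` B" "g i" B ?T]
          continuous_on_subset[OF continuous_on_vec_signed_powr[OF s(1)]]) auto
    then have "odd_map_avoiding_zero B m"
      unfolding odd_map_avoiding_zero_def using g(2,3)
      by (intro exI[of _ "\<lambda>i f. g i (?T f)"]) (auto simp: vec_signed_powr_uminus)
    then show "k \<le> m" using B'(4) by (simp add: kgenus_ge_iff)
  qed
  ultimately show ?thesis by (simp add: genus_family_def)
qed

section \<open>Rayleigh quotients on signed graphs\<close>

locale signed_graph =
  fixes E :: "('v::{finite,linorder}) set set" and \<sigma> w :: "'v set \<Rightarrow> real"
    and \<mu> \<kappa> :: "'v \<Rightarrow> real"
  assumes graph: "simple_graph E" and sign: "signature E \<sigma>"
    and w_pos: "e \<in> E \<Longrightarrow> w e > 0" and \<mu>_pos: "\<mu> v > 0"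
begin

abbreviation "R p f \<equiv> rayleigh E \<sigma> w \<mu> \<kappa> p f"

definition pairs :: "('v \<times> 'v) set" where "pairs = {(i,j). i < j \<and> {i,j} \<in> E}"

definition edge_energy :: "real \<Rightarrow> (real,'v) vec \<Rightarrow> real" where
  "edge_energy p f = (\<Sum>(i,j)\<in>pairs. w {i,j} * \<bar>f $ i - \<sigma> {i,j} * f $ j\<bar> powr p)"

definition potential_energy :: "real \<Rightarrow> (real,'v) vec \<Rightarrow> real" where
  "potential_energy p f = (\<Sum>i\<in>UNIV. \<kappa> i * \<bar>f $ i\<bar> powr p)"

text \<open>A bound for the potential part on every \<open>p\<close>-sphere, uniform in
  \<open>p\<close>, because each \<open>\<mu> i * \<bar>f $ i\<bar> powr p\<close> is at most 1
  there.\<close>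

definition potential_bound :: real where "potential_bound = (\<Sum>i\<in>UNIV. \<bar>\<kappa> i\<bar> / \<mu> i)"

lemma \<sigma>_cases: "e \<in> E \<Longrightarrow> \<sigma> e = 1 \<or> \<sigma> e = -1"
  using sign by (auto simp: signature_def)

lemma rayleigh_on_sphere:
  assumes "f \<in> p_sphere \<mu> p"
  shows "R p f = edge_energy p f + potential_energy p f"
  using assms
  by (simp add: rayleigh_def rq_num_def p_sphere_def edge_energy_def potential_energy_def pairs_def)

lemma coordinate_bound:
  assumes "f \<in> p_sphere \<mu> p"
  shows "\<bar>f $ i\<bar> powr p \<le> 1 / \<mu> i"
proof -
  have "\<mu> i * \<bar>f $ i\<bar> powr p \<le> rq_den \<mu> p f"
    unfolding rq_den_def using \<mu>_pos by (intro member_le_sum) (auto simp: less_imp_le)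
  then show ?thesis
    using assms \<mu>_pos[of i] by (simp add: p_sphere_def field_simps)
qed

lemma abs_potential_energy_le:
  assumes "f \<in> p_sphere \<mu> p"
  shows "\<bar>potential_energy p f\<bar> \<le> potential_bound"
proof -
  have "\<bar>potential_energy p f\<bar> \<le> (\<Sum>i\<in>UNIV. \<bar>\<kappa> i * \<bar>f $ i\<bar> powr p\<bar>)"
    unfolding potential_energy_def by (rule sum_abs)
  also have "\<dots> \<le> potential_bound"
    unfolding potential_bound_def
  proof (rule sum_mono)
    fix i
    have "\<bar>\<kappa> i\<bar> * \<bar>f $ i\<bar> powr p \<le> \<bar>\<kappa> i\<bar> * (1 / \<mu> i)"
      by (intro mult_left_mono coordinate_bound assms) auto
    then show "\<bar>\<kappa> i * \<bar>f $ i\<bar> powr p\<bar> \<le> \<bar>\<kappa> i\<bar> / \<mu> i" by (simp add: abs_mult)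
  qed
  finally show ?thesis .
qed

lemma edge_energy_nonneg: "0 \<le> edge_energy p f"
  unfolding edge_energy_def pairs_def using w_pos by (intro sum_nonneg) (auto simp: less_imp_le)

lemma rayleigh_lower_bound:
  assumes "f \<in> p_sphere \<mu> p"
  shows "- potential_bound \<le> R p f"
  using rayleigh_on_sphere[OF assms] edge_energy_nonneg[of p f] abs_potential_energy_le[OF assms]
  by linarith

text \<open>The bound may depend on \<open>p\<close>; its purpose is that suprema of
  \<open>R p\<close> over subsets of the sphere are genuine ones.\<close>

lemma rayleigh_upper_bound:
  assumes "0 < p"
  obtains U where "\<And>f. f \<in> p_sphere \<mu> p \<Longrightarrow> R p f \<le> U"
proof
  fix f assume f: "f \<in> p_sphere \<mu> p"
  have "edge_energy p f \<le> (\<Sum>(i,j)\<in>pairs. w {i,j} * (2 powr p * (1 / \<mu> i + 1 / \<mu> j)))"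
    unfolding edge_energy_def
  proof (rule sum_mono, clarify)
    fix i j assume "(i, j) \<in> pairs"
    then have e: "{i,j} \<in> E" by (simp add: pairs_def)
    let ?M = "max \<bar>f $ i\<bar> \<bar>f $ j\<bar>"
    have "\<bar>f $ i - \<sigma> {i,j} * f $ j\<bar> \<le> 2 * ?M"
      using \<sigma>_cases[OF e] by auto
    then have "\<bar>f $ i - \<sigma> {i,j} * f $ j\<bar> powr p \<le> (2 * ?M) powr p"
      using assms by (intro powr_mono2) auto
    also have "\<dots> = 2 powr p * ?M powr p" by (simp add: powr_mult)
    also have "?M powr p \<le> \<bar>f $ i\<bar> powr p + \<bar>f $ j\<bar> powr p" by (simp add: max_def)
    also have "\<dots> \<le> 1 / \<mu> i + 1 / \<mu> j" by (intro add_mono coordinate_bound f)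
    finally show "w {i,j} * \<bar>f $ i - \<sigma> {i,j} * f $ j\<bar> powr p \<le> w {i,j} * (2 powr p * (1 / \<mu> i + 1 / \<mu> j))"
      using w_pos[OF e] by simp
  qed
  then show "R p f \<le> (\<Sum>(i,j)\<in>pairs. w {i,j} * (2 powr p * (1 / \<mu> i + 1 / \<mu> j))) + potential_bound"
    using rayleigh_on_sphere[OF f] abs_potential_energy_le[OF f] by linarith
qed

text \<open>The signed power is odd, so it commutes with the factor \<open>\<sigma> e\<close>, and
  \<open>signed_powr_half_dist\<close> applies edge by edge.\<close>

lemma edge_energy_vec_signed_powr:
  assumes "0 < p" "p \<le> q"
  shows "edge_energy q (vec_signed_powr (p / q) f) / 2 powr q \<le> edge_energy p f / 2 powr p"
  unfolding edge_energy_def sum_divide_distrib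
proof (rule sum_mono, clarify)
  fix i j assume "(i, j) \<in> pairs"
  then have e: "{i,j} \<in> E" by (simp add: pairs_def)
  let ?T = "vec_signed_powr (p / q) f"
  let ?d = "\<bar>f $ i - \<sigma> {i,j} * f $ j\<bar>" and ?D = "\<bar>?T $ i - \<sigma> {i,j} * ?T $ j\<bar>"
  have s: "0 < p / q" "p / q \<le> 1" "0 < q" using assms by auto
  have "\<sigma> {i,j} * ?T $ j = signed_powr (p / q) (\<sigma> {i,j} * f $ j)"
    using \<sigma>_cases[OF e] by (auto simp: vec_signed_powr_def signed_powr_uminus)
  then have "?D / 2 \<le> (?d / 2) powr (p / q)"
    using signed_powr_half_dist[OF s(1,2), of "f $ i" "\<sigma> {i,j} * f $ j"]
    by (simp add: vec_signed_powr_def)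
  then have "(?D / 2) powr q \<le> ((?d / 2) powr (p / q)) powr q"
    using s by (intro powr_mono2) auto
  then have "?D powr q / 2 powr q \<le> ?d powr p / 2 powr p"
    using s by (simp add: powr_powr powr_divide)
  then have "w {i,j} * (?D powr q / 2 powr q) \<le> w {i,j} * (?d powr p / 2 powr p)"
    using w_pos[OF e] by (intro mult_left_mono) auto
  then show "w {i,j} * ?D powr q / 2 powr q \<le> w {i,j} * ?d powr p / 2 powr p"
    by simp
qed

text \<open>The transfer fixes the potential part. Adding \<open>potential_bound\<close> makes that
  part nonnegative, so dividing it by the larger power of 2 can only decrease it.\<close>

lemma rayleigh_vec_signed_powr:
  assumes "0 < p" "p \<le> q" and f: "f \<in> p_sphere \<mu> p"
  shows "(R q (vec_signed_powr (p / q) f) + potential_bound) / 2 powr q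
           \<le> (R p f + potential_bound) / 2 powr p"
proof -
  let ?T = "vec_signed_powr (p / q) f"
  have q: "0 < q" using assms by simp
  have T: "?T \<in> p_sphere \<mu> q"
    using f by (simp add: p_sphere_def rq_den_vec_signed_powr[OF q])
  have pe: "potential_energy q ?T = potential_energy p f"
    by (simp add: potential_energy_def abs_vec_signed_powr[OF q])
  have "0 \<le> potential_energy p f + potential_bound"
    using abs_potential_energy_le[OF f] by linarith
  moreover have "2 powr p \<le> 2 powr q" using assms by simp
  ultimately have "(potential_energy p f + potential_bound) / 2 powr q
      \<le> (potential_energy p f + potential_bound) / 2 powr p"
    by (intro divide_left_mono) auto
  then show ?thesis
    using edge_energy_vec_signed_powr[OF assms(1,2), of f]
    unfolding rayleigh_on_sphere[OF f] rayleigh_on_sphere[OF T] pe add_divide_distrib by linarith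
qed

section \<open>Estimates for the variational eigenvalues\<close>

lemma var_eig_le_sup:
  assumes "1 \<le> k" "0 < p" "B \<in> genus_family k (p_sphere \<mu> p)"
  shows "var_eig E \<sigma> w \<mu> \<kappa> p k \<le> (SUP f\<in>B. R p f)"
  unfolding var_eig_def
proof (rule cINF_lower[OF _ assms(3)])
  obtain U where U: "\<And>f. f \<in> p_sphere \<mu> p \<Longrightarrow> R p f \<le> U"
    using rayleigh_upper_bound[OF assms(2)] by blast
  show "bdd_below ((\<lambda>B. SUP f\<in>B. R p f) ` genus_family k (p_sphere \<mu> p))"
  proof (rule bdd_belowI2)
    fix B assume B: "B \<in> genus_family k (p_sphere \<mu> p)"
    then have sub: "B \<subseteq> p_sphere \<mu> p" by (simp add: genus_family_def)
    obtain f where f: "f \<in> B" using genus_family_member_nonempty[OF B assms(1)] by blast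
    have "- potential_bound \<le> R p f" using rayleigh_lower_bound f sub by blast
    also have "\<dots> \<le> (SUP f\<in>B. R p f)"
      using U sub f by (intro cSUP_upper bdd_aboveI2[of _ _ U]) auto
    finally show "- potential_bound \<le> (SUP f\<in>B. R p f)" .
  qed
qed

text \<open>The bound on \<open>k\<close> makes the family nonempty, by Borsuk-Ulam; an infimum over
  the empty family would carry no information.\<close>

lemma le_var_eig:
  assumes "k \<le> CARD('v)" "0 < p"
    and "\<And>B. B \<in> genus_family k (p_sphere \<mu> p) \<Longrightarrow> c \<le> (SUP f\<in>B. R p f)"
  shows "c \<le> var_eig E \<sigma> w \<mu> \<kappa> p k"
  unfolding var_eig_def
  using p_sphere_in_genus_family[of \<mu> p k] \<mu>_pos assms by (intro cINF_greatest) auto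

lemma rayleigh_le_sup:
  assumes "0 < p" "B \<in> genus_family k (p_sphere \<mu> p)" "f \<in> B"
  shows "R p f \<le> (SUP f\<in>B. R p f)"
proof -
  obtain U where "\<And>f. f \<in> p_sphere \<mu> p \<Longrightarrow> R p f \<le> U"
    using rayleigh_upper_bound[OF assms(1)] by blast
  then show ?thesis
    using assms by (intro cSUP_upper bdd_aboveI2[of _ _ U]) (auto simp: genus_family_def)
qed

lemma var_eig_shifted_antimono:
  assumes k: "1 \<le> k" "k \<le> CARD('v)" and pq: "0 < p" "p \<le> q"
  shows "(var_eig E \<sigma> w \<mu> \<kappa> q k + potential_bound) / 2 powr q
           \<le> (var_eig E \<sigma> w \<mu> \<kappa> p k + potential_bound) / 2 powr p"
proof -
  define A where "A = (var_eig E \<sigma> w \<mu> \<kappa> q k + potential_bound) / 2 powr q"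
  have q: "0 < q" using pq by simp
  \<comment> \<open>Solving the claim for the eigenvalue at \<open>p\<close> turns it into a lower
    bound, to be checked on each \<open>B\<close>; the transferred set is then a competitor at
    \<open>q\<close>.\<close>
  have "A * 2 powr p - potential_bound \<le> var_eig E \<sigma> w \<mu> \<kappa> p k"
  proof (rule le_var_eig[OF k(2) pq(1)])
    fix B assume B: "B \<in> genus_family k (p_sphere \<mu> p)"
    define S where "S = (SUP f\<in>B. R p f)"
    let ?TB = "vec_signed_powr (p / q) ` B"
    have TB: "?TB \<in> genus_family k (p_sphere \<mu> q)"
      by (rule vec_signed_powr_genus_family[OF pq(1) q B])
    have "var_eig E \<sigma> w \<mu> \<kappa> q k \<le> (SUP f\<in>?TB. R q f)"
      by (rule var_eig_le_sup[OF k(1) q TB])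
    also have "\<dots> \<le> (S + potential_bound) / 2 powr p * 2 powr q - potential_bound"
    proof (rule cSUP_least)
      show "?TB \<noteq> {}" using genus_family_member_nonempty[OF B k(1)] by simp
      fix h assume "h \<in> ?TB"
      then obtain f where f: "f \<in> B" and h: "h = vec_signed_powr (p / q) f" by blast
      have fS: "f \<in> p_sphere \<mu> p" using f B by (auto simp: genus_family_def)
      have "(R q h + potential_bound) / 2 powr q \<le> (R p f + potential_bound) / 2 powr p"
        unfolding h by (rule rayleigh_vec_signed_powr[OF pq fS])
      also have "\<dots> \<le> (S + potential_bound) / 2 powr p"
        using rayleigh_le_sup[OF pq(1) B f] by (simp add: S_def divide_right_mono)
      finally show "R q h \<le> (S + potential_bound) / 2 powr p * 2 powr q - potential_bound"
        by (simp add: pos_divide_le_eq)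
    qed
    finally have "A \<le> (S + potential_bound) / 2 powr p"
      by (simp add: A_def pos_divide_le_eq)
    then show "A * 2 powr p - potential_bound \<le> S" by (simp add: pos_le_divide_eq)
  qed
  then show ?thesis unfolding A_def[symmetric] by (simp add: pos_le_divide_eq)
qed

lemma edge_Min_Max:
  assumes "e \<in> E"
  shows "Min e < Max e" "e = {Min e, Max e}"
proof -
  obtain i j where ij: "i \<noteq> j" "e = {i, j}" using graph assms by (auto simp: simple_graph_def)
  then show "Min e < Max e" "e = {Min e, Max e}"
    by (auto simp: min_def max_def)
qed

text \<open>An odd map with one component \<open>f i + \<sigma> e * f j\<close> per covering edge \<open>e = {i, j}\<close> must
  vanish somewhere on a set of larger genus; there the covering edge \<open>e\<close> contributes the maximal
  amount \<open>w e * (2 * \<bar>f i\<bar>) powr p\<close>.\<close>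

lemma rayleigh_lower_bound_edge_cover:
  assumes C: "edge_cover E C" and k: "card C < k"
  obtains c where "0 < c"
    "\<And>p B. B \<in> genus_family k (p_sphere \<mu> p) \<Longrightarrow> \<exists>f\<in>B. c * 2 powr p - potential_bound \<le> R p f"
proof -
  have CE: "C \<subseteq> E" and cover: "\<And>v. \<exists>e\<in>C. v \<in> e"
    using C by (auto simp: edge_cover_def)
  \<comment> \<open>The smallest ratio of an edge weight to a vertex measure, divided by the number
    of vertices because only that share of the normalised mass is guaranteed at some vertex.\<close>
  define c where "c = Min ((\<lambda>(e,v). w e / \<mu> v) ` (E \<times> UNIV)) / CARD('v)"
  have ne: "E \<times> (UNIV :: 'v set) \<noteq> {}" using cover CE by fast
  have c_le: "c \<le> w e / \<mu> v / CARD('v)" if "e \<in> E" for e v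
    unfolding c_def using that by (intro divide_right_mono Min_le) (auto intro!: image_eqI[of _ _ "(e,v)"])
  have c_pos: "0 < c"
    unfolding c_def using ne w_pos \<mu>_pos by (intro divide_pos_pos) (auto simp: Min_gr_iff)
  obtain en where en: "bij_betw en {..<card C} C"
    using ex_bij_betw_nat_finite[of C] by (auto simp: atLeast0LessThan)
  show thesis
  proof (rule that[OF c_pos])
    fix p B assume B: "B \<in> genus_family k (p_sphere \<mu> p)"
    define g where "g i f = f $ Min (en i) + \<sigma> (en i) * f $ Max (en i)" for i and f :: "(real,'v) vec"
    have "\<not> odd_map_avoiding_zero B (card C)"
      using B k kgenus_ge_iff[of k B] by (force simp: genus_family_def)
    moreover have "continuous_on B (g i)" for i
      unfolding g_def by (intro continuous_intros)
    moreover have "g i (- f) = - g i f" for i f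
      by (simp add: g_def)
    ultimately obtain f where f: "f \<in> B" and g0: "\<And>i. i < card C \<Longrightarrow> g i f = 0"
      unfolding odd_map_avoiding_zero_def by blast
    have anti: "f $ Min e = - \<sigma> e * f $ Max e" if "e \<in> C" for e
    proof -
      have "e \<in> en ` {..<card C}" using en that by (simp add: bij_betw_def)
      then obtain i where "i < card C" "en i = e" by auto
      then show ?thesis using g0[of i] by (simp add: g_def)
    qed
    have fS: "f \<in> p_sphere \<mu> p" using f B by (auto simp: genus_family_def)
    \<comment> \<open>Pigeonhole: the masses of the vertices add up to 1.\<close>
    have "\<exists>v. 1 / CARD('v) \<le> \<mu> v * \<bar>f $ v\<bar> powr p"
    proof (rule ccontr)
      assume "\<not> ?thesis"
      then have "(\<Sum>v\<in>UNIV. \<mu> v * \<bar>f $ v\<bar> powr p) < (\<Sum>v\<in>(UNIV :: 'v set). 1 / CARD('v))"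
        by (intro sum_strict_mono) (auto simp: not_le)
      then show False using fS by (simp add: p_sphere_def rq_den_def)
    qed
    then obtain v where v: "1 / CARD('v) \<le> \<mu> v * \<bar>f $ v\<bar> powr p" by blast
    obtain e where e: "e \<in> C" "v \<in> e" using cover by blast
    have eE: "e \<in> E" using e CE by blast
    note mm = edge_Min_Max[OF eE]
    have \<sigma>: "\<sigma> e = 1 \<or> \<sigma> e = -1" by (rule \<sigma>_cases[OF eE])
    \<comment> \<open>\<open>v\<close> is one of the two ends of \<open>e\<close>, and by
      \<open>anti\<close> both ends carry the same absolute value.\<close>
    have fv: "\<bar>f $ v\<bar> = \<bar>f $ Max e\<bar>"
      using e(2) mm(2) anti[OF e(1)] \<sigma> by (metis abs_minus_cancel insertE mult_1 mult_minus1 empty_iff minus_minus)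
    have "\<bar>f $ Min e - \<sigma> e * f $ Max e\<bar> = 2 * \<bar>f $ v\<bar>"
      unfolding fv anti[OF e(1)] using \<sigma> by (auto simp: abs_mult)
    then have "w e * \<bar>f $ Min e - \<sigma> e * f $ Max e\<bar> powr p = w e * (2 powr p * \<bar>f $ v\<bar> powr p)"
      by (simp add: powr_mult)
    moreover have "w e * \<bar>f $ Min e - \<sigma> e * f $ Max e\<bar> powr p \<le> edge_energy p f"
    proof -
      have "(Min e, Max e) \<in> pairs" using mm eE by (simp add: pairs_def)
      then have "(\<lambda>(i,j). w {i,j} * \<bar>f $ i - \<sigma> {i,j} * f $ j\<bar> powr p) (Min e, Max e) \<le> edge_energy p f"
        unfolding edge_energy_def using w_pos
        by (intro member_le_sum) (auto simp: pairs_def less_imp_le)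
      then show ?thesis using mm(2) by simp
    qed
    moreover have "c * 2 powr p \<le> w e * (2 powr p * \<bar>f $ v\<bar> powr p)"
    proof -
      have "1 / CARD('v) / \<mu> v \<le> \<bar>f $ v\<bar> powr p"
        using v \<mu>_pos[of v] by (simp add: pos_divide_le_eq mult_ac)
      then have "w e * (1 / CARD('v) / \<mu> v) \<le> w e * \<bar>f $ v\<bar> powr p"
        using w_pos[OF eE] by (intro mult_left_mono) auto
      then have "c \<le> w e * \<bar>f $ v\<bar> powr p"
        using c_le[OF eE, of v] by (simp add: field_simps)
      then have "c * 2 powr p \<le> w e * \<bar>f $ v\<bar> powr p * 2 powr p"
        by (intro mult_right_mono) auto
      then show ?thesis by (simp add: mult_ac)
    qed
    ultimately have "c * 2 powr p \<le> edge_energy p f" by linarith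
    then have "c * 2 powr p - potential_bound \<le> R p f"
      using rayleigh_on_sphere[OF fS] abs_potential_energy_le[OF fS] by linarith
    then show "\<exists>f\<in>B. c * 2 powr p - potential_bound \<le> R p f" using f by blast
  qed
qed

text \<open>\<open>Lim\<close> is informative only after convergence is known. The shifted quotient
  \<open>h\<close> is antimonotone and at least \<open>c\<close> from \<open>p = 1\<close> on, so it
  converges to a limit that is at least \<open>c\<close>.\<close>

lemma cutoff_eig_pos:
  assumes C: "edge_cover E C" "card C < k" and k: "k \<le> CARD('v)"
  shows "0 < cutoff_eig E \<sigma> w \<mu> \<kappa> k"
proof -
  let ?v = "\<lambda>p. var_eig E \<sigma> w \<mu> \<kappa> p k"
  define h where "h p = (?v p + potential_bound) / 2 powr p" for p
  obtain c where c: "0 < c" and low: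
    "\<And>p B. B \<in> genus_family k (p_sphere \<mu> p) \<Longrightarrow> \<exists>f\<in>B. c * 2 powr p - potential_bound \<le> R p f"
    using rayleigh_lower_bound_edge_cover[OF C] by metis
  have k1: "1 \<le> k" using C by simp
  have ch: "c \<le> h p" if p: "1 \<le> p" for p
  proof -
    have "c * 2 powr p - potential_bound \<le> ?v p"
    proof (rule le_var_eig[OF k])
      fix B assume B: "B \<in> genus_family k (p_sphere \<mu> p)"
      then obtain f where f: "f \<in> B" "c * 2 powr p - potential_bound \<le> R p f" using low by blast
      have "R p f \<le> (SUP f\<in>B. R p f)" using p by (intro rayleigh_le_sup[OF _ B f(1)]) simp
      with f(2) show "c * 2 powr p - potential_bound \<le> (SUP f\<in>B. R p f)" by linarith
    qed (use p in simp)
    then show ?thesis by (simp add: h_def pos_le_divide_eq)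
  qed
  have "h q \<le> h p" if "1 \<le> p" "p \<le> q" for p q
    unfolding h_def using that by (intro var_eig_shifted_antimono k1 k) auto
  then obtain L where L: "(h \<longlongrightarrow> L) at_top"
    using tendsto_at_top_antimono_bounded[of 1 h c] ch by blast
  have "c \<le> L"
    using ch by (intro tendsto_lowerbound[OF L] eventually_mono[OF eventually_ge_at_top[of 1]]) auto
  \<comment> \<open>The shift disappears in the limit, so the unshifted quotient has the same limit
    \<open>L\<close>.\<close>
  moreover have "((\<lambda>p::real. 1 / 2 powr p) \<longlongrightarrow> (0::real)) at_top"
    by real_asymp
  then have "((\<lambda>p. potential_bound / 2 powr p) \<longlongrightarrow> 0) at_top"
    using tendsto_mult_right_zero by fastforce
  then have "((\<lambda>p. h p - potential_bound / 2 powr p) \<longlongrightarrow> L - 0) at_top"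
    by (intro tendsto_diff L)
  then have "((\<lambda>p. ?v p / 2 powr p) \<longlongrightarrow> L) at_top"
    by (simp add: h_def add_divide_distrib)
  then have "cutoff_eig E \<sigma> w \<mu> \<kappa> k = L"
    unfolding cutoff_eig_def by (intro tendsto_Lim) auto
  ultimately show ?thesis using c by simp
qed

end

section \<open>Minimum edge covers and the counting bound\<close>

lemma min_edge_cover_attained:
  fixes E :: "('v::{finite,linorder}) set set"
  assumes "no_isolated_vertices E"
  obtains C where "edge_cover E C" "card C = min_edge_cover_card E"
proof -
  have "edge_cover E E"
    using assms by (auto simp: edge_cover_def no_isolated_vertices_def)
  then have "{card C | C. edge_cover E C} \<noteq> {}" by blast
  moreover have "finite {card C | C. edge_cover E C}" by simp
  ultimately have "min_edge_cover_card E \<in> {card C | C. edge_cover E C}"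
    unfolding min_edge_cover_card_def by (intro Min_in)
  then show ?thesis using that by auto
qed

theorem theorem6p3:
  fixes E :: "('v::{finite,linorder}) set set"
    and w :: "'v set \<Rightarrow> real" and \<mu> :: "'v \<Rightarrow> real" and \<kappa> :: "'v \<Rightarrow> real"
  assumes "simple_graph E"
    and "no_isolated_vertices E"
    and "\<forall>e\<in>E. w e > 0"
    and "\<forall>v. \<mu> v > 0"
  shows "\<forall>\<sigma>. signature E \<sigma> \<longrightarrow>
           card {k \<in> {1..CARD('v)}. cutoff_eig E \<sigma> w \<mu> \<kappa> k = 0} \<le> min_edge_cover_card E"
proof (intro allI impI)
  fix \<sigma> assume \<sigma>: "signature E \<sigma>"
  interpret signed_graph E \<sigma> w \<mu> \<kappa>
    using assms \<sigma> by unfold_locales auto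
  obtain C where C: "edge_cover E C" "card C = min_edge_cover_card E"
    using min_edge_cover_attained[OF assms(2)] .
  \<comment> \<open>Every index above \<open>card C\<close> has a positive cut-off eigenvalue, so
    the zeros occur only among the indices up to the covering number.\<close>
  have "{k \<in> {1..CARD('v)}. cutoff_eig E \<sigma> w \<mu> \<kappa> k = 0} \<subseteq> {1..min_edge_cover_card E}"
  proof
    fix k assume "k \<in> {k \<in> {1..CARD('v)}. cutoff_eig E \<sigma> w \<mu> \<kappa> k = 0}"
    then show "k \<in> {1..min_edge_cover_card E}"
      using cutoff_eig_pos[OF C(1), of k] C(2) by (cases "card C < k") auto
  qed
  then have "card {k \<in> {1..CARD('v)}. cutoff_eig E \<sigma> w \<mu> \<kappa> k = 0} \<le> card {1..min_edge_cover_card E}"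
    by (intro card_mono) auto
  then show "card {k \<in> {1..CARD('v)}. cutoff_eig E \<sigma> w \<mu> \<kappa> k = 0} \<le> min_edge_cover_card E"
    by simp
qed

end
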